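(* Let $n\ge 1$ and let $I = I(C_{2n+1})\subseteq K[x_1,\ldots,x_{2n+1}]$ be the edge ideal of the odd cycle $C_{2n+1}$. Then the resurgence of $I$ is $\rho(I) = \dfrac{2n+2}{2n+1}$.
   Context: $K$ is an algebraically closed field. $C_{2n+1}$ is the cycle graph with vertices $x_1,\ldots,x_{2n+1}$ and edges $\{x_j,x_{j+1}\}$ for $1\le j\le 2n$ and $\{x_{2n+1},x_1\}$. The edge ideal $I(G)$ of a simple graph $G$ on the variables is the ideal generated by all products $x_ix_j$ with $\{x_i,x_j\}$ an edge of $G$. The $m$th symbolic power of an ideal $I$ of a polynomial ring $S$ is $I^{(m)} = S\cap\bigcap_{P\in \mathrm{Ass}(I)} I^m S_P$. The resurgence of a nonzero proper homogeneous ideal $I$ is $\rho(I) = \sup\{m/r \mid m,r\ge 1 \text{ integers},\ I^{(m)}\not\subseteq I^r\}$. *)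

theory Defs
  imports
    "HOL-Library.Poly_Mapping"
    "HOL-Library.Extended_Real"
    "HOL-Computational_Algebra.Polynomial"
    "HOL-Computational_Algebra.Fraction_Field"
    "HOL-Algebra.Ideal_Product"
begin

section \<open>Polynomial rings in a prescribed set of variables\<close>

definition subring_on :: "'a::comm_ring_1 set \<Rightarrow> 'a ring"
  where "subring_on A = \<lparr>carrier = A, mult = (*), one = 1, zero = 0, add = (+)\<rparr>"

text \<open>
  The type \<open>('v \<Rightarrow>\<^sub>0 nat) \<Rightarrow>\<^sub>0 'a\<close> is the polynomial ring over \<open>'a\<close> in all the
  variables of type \<open>'v\<close>: keys are monomials, given by their exponents. \<open>mpoly_ring V\<close> is
  the polynomial ring in exactly the variables \<open>V\<close>.
\<close>

definition mpoly_ring :: "'v set \<Rightarrow> (('v \<Rightarrow>\<^sub>0 nat) \<Rightarrow>\<^sub>0 'a::comm_ring_1) ring"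
  where "mpoly_ring V = subring_on {p. \<forall>t\<in>Poly_Mapping.keys p. Poly_Mapping.keys t \<subseteq> V}"

definition mvar :: "'v \<Rightarrow> ('v \<Rightarrow>\<^sub>0 nat) \<Rightarrow>\<^sub>0 'a::comm_ring_1"
  where "mvar i = Poly_Mapping.single (Poly_Mapping.single i 1) 1"

section \<open>Symbolic powers and resurgence\<close>

text \<open>
  Throughout this section \<open>R\<close> is meant to be a subring of a domain, i.e. of the form
  \<open>subring_on A\<close>, so that its field of fractions lies in the type of fractions. Powers of
  ideals are powers in the monoid \<open>ideals_set R\<close> of ideals under the ideal product.
\<close>

text \<open>The associated primes of \<open>I\<close> are those of the module \<open>R/I\<close>: the primes of the form
  \<open>(I : f) = Ann (f + I)\<close>.\<close>

definition Ass :: "('a, 'b) ring_scheme \<Rightarrow> 'a set \<Rightarrow> 'a set set"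
  where "Ass R I =
    {P. primeideal P R \<and> (\<exists>f\<in>carrier R. P = {g \<in> carrier R. g \<otimes>\<^bsub>R\<^esub> f \<in> I})}"

definition localization :: "'a::idom ring \<Rightarrow> 'a set \<Rightarrow> 'a fract ring"
  where "localization R P = subring_on {Fract f s |f s. f \<in> carrier R \<and> s \<in> carrier R - P}"

text \<open>The intersection of \<open>R\<close> with the extensions of \<open>I\<^sup>m\<close> to the \<open>R\<^sub>P\<close>, taken in the
  field of fractions and pulled back along \<open>f \<mapsto> f/1\<close>.\<close>

definition symbolic_power :: "'a::idom ring \<Rightarrow> 'a set \<Rightarrow> nat \<Rightarrow> 'a set"
  where "symbolic_power R I m =
    {f \<in> carrier R. \<forall>P\<in>Ass R I.
       Fract f 1 \<in> Idl\<^bsub>localization R P\<^esub> ((\<lambda>g. Fract g 1) ` (I [^]\<^bsub>ideals_set R\<^esub> m))}"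

text \<open>The supremum is taken in the extended reals, so that it is never a default value.\<close>

definition resurgence :: "'a::idom ring \<Rightarrow> 'a set \<Rightarrow> ereal"
  where "resurgence R I =
    Sup {ereal (real m / real r) |m r. m \<ge> 1 \<and> r \<ge> 1 \<and>
      \<not> symbolic_power R I m \<subseteq> I [^]\<^bsub>ideals_set R\<^esub> r}"

section \<open>Edge ideals\<close>

text \<open>A graph on \<open>V\<close> is given by its set of edges, each edge being a two-element subset
  of \<open>V\<close>.\<close>

definition edge_ideal :: "'v set \<Rightarrow> 'v set set \<Rightarrow> (('v \<Rightarrow>\<^sub>0 nat) \<Rightarrow>\<^sub>0 'a::comm_ring_1) set"
  where "edge_ideal V E = Idl\<^bsub>mpoly_ring V\<^esub> {mvar i * mvar j |i j. {i, j} \<in> E}"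

definition cycle_edges :: "nat \<Rightarrow> nat set set"
  where "cycle_edges N = {{j, j + 1} |j. 1 \<le> j \<and> j < N} \<union> {{N, 1}}"

section \<open>The records above are commutative rings\<close>

lemma cring_subring_on:
  fixes A :: "'a::comm_ring_1 set"
  assumes "0 \<in> A" "1 \<in> A"
    and add: "\<And>x y. x \<in> A \<Longrightarrow> y \<in> A \<Longrightarrow> x + y \<in> A"
    and mult: "\<And>x y. x \<in> A \<Longrightarrow> y \<in> A \<Longrightarrow> x * y \<in> A"
    and neg: "\<And>x. x \<in> A \<Longrightarrow> - x \<in> A"
  shows "cring (subring_on A)"
proof (rule cringI)
  show "abelian_group (subring_on A)"
  proof (rule abelian_groupI)
    fix x assume "x \<in> carrier (subring_on A)"
    then show "\<exists>y\<in>carrier (subring_on A). y \<oplus>\<^bsub>subring_on A\<^esub> x = \<zero>\<^bsub>subring_on A\<^esub>"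
      using neg by (intro bexI[of _ "- x"]) (auto simp: subring_on_def)
  qed (use assms in \<open>auto simp: subring_on_def algebra_simps\<close>)
  show "comm_monoid (subring_on A)"
    by (rule comm_monoidI) (use assms in \<open>auto simp: subring_on_def algebra_simps\<close>)
qed (auto simp: subring_on_def algebra_simps)

lemma cring_mpoly_ring: "cring (mpoly_ring V :: (('v \<Rightarrow>\<^sub>0 nat) \<Rightarrow>\<^sub>0 'a::comm_ring_1) ring)"
  unfolding mpoly_ring_def
proof (rule cring_subring_on; clarsimp)
  fix x y :: "('v \<Rightarrow>\<^sub>0 nat) \<Rightarrow>\<^sub>0 'a" and t :: "'v \<Rightarrow>\<^sub>0 nat" and v
  assume xy: "\<forall>t\<in>Poly_Mapping.keys x. Poly_Mapping.keys t \<subseteq> V"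
    "\<forall>t\<in>Poly_Mapping.keys y. Poly_Mapping.keys t \<subseteq> V"
    and v: "v \<in> Poly_Mapping.keys t"
  show "v \<in> V" if "t \<in> Poly_Mapping.keys (x + y)"
    using Poly_Mapping.keys_add[of x y] that xy v by blast
  show "v \<in> V" if t: "t \<in> Poly_Mapping.keys (x * y)"
  proof -
    obtain a b where "a \<in> Poly_Mapping.keys x" "b \<in> Poly_Mapping.keys y" "t = a + b"
      using Poly_Mapping.keys_mult[of x y] t by blast
    then show ?thesis
      using Poly_Mapping.keys_add[of a b] xy v by blast
  qed
qed

lemma cring_localization:
  fixes A :: "'a::idom set"
  assumes "primeideal P (subring_on A)"
  shows "cring (localization (subring_on A) P)"
proof -
  interpret primeideal P "subring_on A" by (rule assms)
  have mem: "0 \<in> A" "1 \<in> A"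
    and add: "\<And>x y. x \<in> A \<Longrightarrow> y \<in> A \<Longrightarrow> x + y \<in> A"
    and mult: "\<And>x y. x \<in> A \<Longrightarrow> y \<in> A \<Longrightarrow> x * y \<in> A"
    using zero_closed one_closed a_closed m_closed by (auto simp: subring_on_def)
  have neg: "- x \<in> A" if "x \<in> A" for x
  proof -
    have "x \<in> carrier (subring_on A)" using that by (simp add: subring_on_def)
    then have "\<ominus>\<^bsub>subring_on A\<^esub> x \<in> carrier (subring_on A)"
      "\<ominus>\<^bsub>subring_on A\<^esub> x \<oplus>\<^bsub>subring_on A\<^esub> x = \<zero>\<^bsub>subring_on A\<^esub>"
      by (rule a_inv_closed, rule l_neg)
    then have "\<ominus>\<^bsub>subring_on A\<^esub> x \<in> A" "\<ominus>\<^bsub>subring_on A\<^esub> x + x = 0"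
      by (simp_all add: subring_on_def)
    then show ?thesis by (metis eq_neg_iff_add_eq_0)
  qed
  have one: "1 \<notin> P" using one_imp_carrier I_notcarr by (auto simp: subring_on_def)
  have zero: "0 \<in> P" using additive_subgroup.zero_closed[OF additive_subgroup_axioms]
    by (simp add: subring_on_def)
  have prime: "x * y \<in> A - P" if "x \<in> A - P" "y \<in> A - P" for x y
    using I_prime[of x y] mult that by (auto simp: subring_on_def)
  have nz: "s \<noteq> 0" if "s \<in> A - P" for s using that zero by auto
  have eq: "localization (subring_on A) P = subring_on {Fract f s |f s. f \<in> A \<and> s \<in> A - P}"
    by (simp add: localization_def subring_on_def)
  show ?thesis unfolding eq
  proof (rule cring_subring_on)
    show "0 \<in> {Fract f s |f s. f \<in> A \<and> s \<in> A - P}"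
      using mem one by (auto simp: Zero_fract_def)
    show "1 \<in> {Fract f s |f s. f \<in> A \<and> s \<in> A - P}"
      using mem one by (auto simp: One_fract_def)
  next
    fix x y assume "x \<in> {Fract f s |f s. f \<in> A \<and> s \<in> A - P}"
      "y \<in> {Fract f s |f s. f \<in> A \<and> s \<in> A - P}"
    then obtain f s g t where *: "x = Fract f s" "f \<in> A" "s \<in> A - P"
      "y = Fract g t" "g \<in> A" "t \<in> A - P" by blast
    have "x + y = Fract (f * t + g * s) (s * t)" using * nz by simp
    moreover have "f * t + g * s \<in> A" using * add mult by auto
    ultimately show "x + y \<in> {Fract f s |f s. f \<in> A \<and> s \<in> A - P}"
      using prime[of s t] * by blast
    have "x * y = Fract (f * g) (s * t)" using * by simp
    then show "x * y \<in> {Fract f s |f s. f \<in> A \<and> s \<in> A - P}"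
      using prime[of s t] mult[of f g] * by blast
  next
    fix x assume "x \<in> {Fract f s |f s. f \<in> A \<and> s \<in> A - P}"
    then show "- x \<in> {Fract f s |f s. f \<in> A \<and> s \<in> A - P}"
      using neg by (force simp: minus_fract)
  qed
qed

end

theory Submission
  imports Defs
begin

text \<open>
  The symbolic power \<open>I\<^sup>(\<^sup>m\<^sup>)\<close> of an edge ideal is spanned by the monomials \<open>x\<^sup>t\<close> whose weight
  \<open>\<Sum>i\<in>W. t\<^sub>i\<close> on every vertex cover \<open>W\<close> is at least \<open>m\<close>, and \<open>x\<^sup>t\<close> lies in \<open>I\<^sup>r\<close> if \<open>t\<close>
  dominates a sum of \<open>r\<close> edges. On an odd cycle such edges exist as soon as every vertex cover has
  weight at least \<open>r\<close> and the total weight is at least \<open>2r\<close>, a Koenig theorem with one extra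
  condition. Averaging over the minimum covers gives \<open>(2n+1) m \<le> (n+1) \<bar>t\<bar>\<close> for \<open>x\<^sup>t\<close> in
  \<open>I\<^sup>(\<^sup>m\<^sup>)\<close>, hence the upper bound. The lower bound comes from
  \<open>(x\<^sub>1 \<cdots> x\<^bsub>2n+1\<^esub>)\<^bsup>2l\<^esup>\<close>, which lies in \<open>I\<^sup>(\<^sup>m\<^sup>)\<close> for \<open>m = 2l(n+1)\<close> and, by
  its degree, not in \<open>I\<^sup>r\<close> for \<open>r = l(2n+1)+1\<close>; let \<open>l\<close> tend to infinity.
\<close>

section \<open>Ideals and localizations of subrings\<close>

lemma carrier_subring_on [simp]: "carrier (subring_on A) = A"
  and mult_subring_on [simp]: "mult (subring_on A) = (*)"
  and one_subring_on [simp]: "one (subring_on A) = 1"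
  and zero_subring_on [simp]: "zero (subring_on A) = 0"
  and add_subring_on [simp]: "add (subring_on A) = (+)"
  by (simp_all add: subring_on_def)

lemma a_inv_subring_on:
  assumes "cring (subring_on A)" "x \<in> A"
  shows "\<ominus>\<^bsub>subring_on A\<^esub> x = - x"
proof -
  interpret cring "subring_on A" by (rule assms)
  have "\<ominus>\<^bsub>subring_on A\<^esub> x + x = 0" using l_neg[of x] assms(2) by simp
  then show ?thesis by (simp add: eq_neg_iff_add_eq_0)
qed

lemma uminus_subring_on:
  assumes "cring (subring_on A)" "x \<in> A"
  shows "- x \<in> A"
  using abelian_group.a_inv_closed[of "subring_on A" x] a_inv_subring_on[OF assms] assms
  by (simp add: cring_def ring_def)

text \<open>Closure under negation comes for free: the ring contains -1, so it is a case of
  \<open>mult\<close>.\<close>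

lemma ideal_subring_onI:
  assumes R: "cring (subring_on A)" and "J \<subseteq> A" "0 \<in> J"
    and add: "\<And>x y. x \<in> J \<Longrightarrow> y \<in> J \<Longrightarrow> x + y \<in> J"
    and mult: "\<And>a x. a \<in> A \<Longrightarrow> x \<in> J \<Longrightarrow> a * x \<in> J"
  shows "ideal J (subring_on A)"
proof -
  interpret cring "subring_on A" by (rule R)
  have one: "1 \<in> A" using one_closed by simp
  have neg: "- x \<in> J" if "x \<in> J" for x
    using mult[OF uminus_subring_on[OF R one] that] by simp
  show ?thesis
  proof (rule idealI)
    show "subgroup J (add_monoid (subring_on A))"
    proof (rule add.subgroupI)
      fix x assume "x \<in> J"
      moreover have "\<ominus>\<^bsub>subring_on A\<^esub> x = - x"
        using a_inv_subring_on[OF R] \<open>x \<in> J\<close> \<open>J \<subseteq> A\<close> by blast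
      ultimately show "\<ominus>\<^bsub>subring_on A\<^esub> x \<in> J" using neg by simp
    qed (use assms in auto)
  next
    fix x a assume "x \<in> J" "a \<in> carrier (subring_on A)"
    then show "a \<otimes>\<^bsub>subring_on A\<^esub> x \<in> J" "x \<otimes>\<^bsub>subring_on A\<^esub> a \<in> J"
      using mult[of a x] by (simp_all add: mult.commute)
  qed (rule ring_axioms)
qed

lemma ideal_subring_onD:
  assumes "ideal J (subring_on A)"
  shows "J \<subseteq> A" "0 \<in> J" "x \<in> J \<Longrightarrow> y \<in> J \<Longrightarrow> x + y \<in> J" "a \<in> A \<Longrightarrow> x \<in> J \<Longrightarrow> a * x \<in> J"
proof -
  interpret ideal J "subring_on A" by (rule assms)
  show "J \<subseteq> A" using Icarr by auto
  show "0 \<in> J" using additive_subgroup.zero_closed[OF additive_subgroup_axioms] by simp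
  show "x \<in> J \<Longrightarrow> y \<in> J \<Longrightarrow> x + y \<in> J" using additive_subgroup.a_closed[OF additive_subgroup_axioms, of x y] by simp
  show "a \<in> A \<Longrightarrow> x \<in> J \<Longrightarrow> a * x \<in> J" using I_l_closed[of x a] by simp
qed

section \<open>Powers of ideals\<close>

lemma one_ideals_set [simp]: "one (ideals_set R) = carrier R"
  and mult_ideals_set [simp]: "mult (ideals_set R) = ideal_prod R"
  by (simp_all add: ideals_set_def)

lemma ideal_pow_0 [simp]: "I [^]\<^bsub>ideals_set R\<^esub> (0::nat) = carrier R"
  and ideal_pow_Suc [simp]: "I [^]\<^bsub>ideals_set R\<^esub> Suc m = ideal_prod R (I [^]\<^bsub>ideals_set R\<^esub> m) I"
  by (simp_all add: nat_pow_def)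

lemma (in ring) ideal_pow_is_ideal:
  assumes "ideal I R"
  shows "ideal (I [^]\<^bsub>ideals_set R\<^esub> (m::nat)) R"
  by (induction m) (use assms in \<open>auto intro: oneideal ideal_prod_is_ideal\<close>)

text \<open>Elements of an ideal product arise from products \<open>x * y\<close> by sums, so
  induction over \<open>ideal_prod\<close> reduces the claim to the two closure conditions. Below,
  \<open>D\<close> is a filtration by degree in some of the variables.\<close>

lemma ideal_pow_subset_filtration:
  fixes I :: "'a::comm_ring_1 set" and m :: nat
  assumes "A \<subseteq> D 0"
    and add: "\<And>k x y. x \<in> D k \<Longrightarrow> y \<in> D k \<Longrightarrow> x + y \<in> D k"
    and mult: "\<And>k x y. x \<in> D k \<Longrightarrow> y \<in> I \<Longrightarrow> x * y \<in> D (Suc k)"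
  shows "I [^]\<^bsub>ideals_set (subring_on A)\<^esub> m \<subseteq> D m"
proof (induction m)
  case 0
  then show ?case using assms by simp
next
  case (Suc m)
  show ?case
  proof
    fix x assume "x \<in> I [^]\<^bsub>ideals_set (subring_on A)\<^esub> Suc m"
    then have "x \<in> ideal_prod (subring_on A) (I [^]\<^bsub>ideals_set (subring_on A)\<^esub> m) I" by simp
    then show "x \<in> D (Suc m)"
      by (induction rule: ideal_prod.induct) (use Suc add mult in auto)
  qed
qed

lemma power_mem_ideal_pow:
  fixes x y :: "'a::comm_ring_1"
  assumes "x \<in> I [^]\<^bsub>ideals_set (subring_on A)\<^esub> m" "y \<in> I"
  shows "x * y ^ k \<in> I [^]\<^bsub>ideals_set (subring_on A)\<^esub> (m + k)"
proof (induction k)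
  case (Suc k)
  then show ?case
    using ideal_prod.prod[of "x * y ^ k" _ y I "subring_on A"] assms(2)
    by (simp add: algebra_simps)
qed (use assms in simp)

lemma prod_power_mem_ideal_pow:
  fixes p :: "'b \<Rightarrow> 'a::comm_ring_1"
  assumes "cring (subring_on A)" "finite S" "\<And>j. j \<in> S \<Longrightarrow> p j \<in> I"
  shows "(\<Prod>j\<in>S. p j ^ y j) \<in> I [^]\<^bsub>ideals_set (subring_on A)\<^esub> (\<Sum>j\<in>S. y j)"
  using assms(2,3)
proof (induction S rule: finite_induct)
  case empty
  then show ?case using ring.ring_simprules(6)[OF cring.axioms(1)[OF assms(1)]] by simp
next
  case (insert j S)
  then show ?case
    using power_mem_ideal_pow[where x = "\<Prod>j\<in>S. p j ^ y j" and A = A and I = I and m = "\<Sum>j\<in>S. y j" and y = "p j" and k = "y j"]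
    by (simp add: mult.commute add.commute)
qed

lemma ideal_pow_antimono:
  fixes I :: "'a::comm_ring_1 set"
  assumes "cring (subring_on A)" "ideal I (subring_on A)" "m \<le> m'"
  shows "I [^]\<^bsub>ideals_set (subring_on A)\<^esub> (m'::nat) \<subseteq> I [^]\<^bsub>ideals_set (subring_on A)\<^esub> m"
  using assms(3)
proof (induction m' rule: dec_induct)
  case (step k)
  interpret cring "subring_on A" by (rule assms)
  show ?case using step ideal_prod_inter[OF ideal_pow_is_ideal[OF assms(2), of k] assms(2)] by auto
qed simp

text \<open>The extension of \<open>J\<close> to the localization consists of the fractions with
  numerator in \<open>J\<close> and denominator outside \<open>P\<close>; clearing the denominator
  yields \<open>s\<close>. Symbolic powers can then be treated inside the polynomial ring, without
  fractions.\<close>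

lemma Fract_mem_Idl_localization_iff:
  fixes A J :: "'a::idom set"
  assumes P: "primeideal P (subring_on A)" and J: "ideal J (subring_on A)" and f: "f \<in> A"
  shows "Fract f 1 \<in> Idl\<^bsub>localization (subring_on A) P\<^esub> ((\<lambda>g. Fract g 1) ` J)
    \<longleftrightarrow> (\<exists>s\<in>A - P. s * f \<in> J)"
proof -
  interpret P: primeideal P "subring_on A" by (rule P)
  define B where "B = {Fract f s |f s. f \<in> A \<and> s \<in> A - P}"
  have loc: "localization (subring_on A) P = subring_on B"
    by (simp add: localization_def B_def)
  have R: "cring (subring_on A)" by (rule P.is_cring)
  have L: "cring (subring_on B)"
    using cring_localization[OF P] loc by simp
  interpret L: cring "subring_on B" by (rule L)
  have one: "1 \<in> A" "1 \<notin> P" using P.one_imp_carrier P.I_notcarr P.one_closed by auto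
  have zero: "0 \<in> P" using P.I_l_closed[of _ 0] additive_subgroup.zero_closed[OF P.additive_subgroup_axioms] by simp
  have prime: "x * y \<in> A - P" if "x \<in> A - P" "y \<in> A - P" for x y
    using P.I_prime[of x y] P.m_closed[of x y] that by auto
  note Jd = ideal_subring_onD[OF J]
  have sub: "(\<lambda>g. Fract g 1) ` J \<subseteq> carrier (subring_on B)"
    using Jd(1) one by (auto simp: B_def)
  show ?thesis
    unfolding loc
  proof
    assume l: "Fract f 1 \<in> Idl\<^bsub>subring_on B\<^esub> ((\<lambda>g. Fract g 1) ` J)"
    define K where "K = {Fract g s |g s. g \<in> J \<and> s \<in> A - P}"
    have "ideal K (subring_on B)"
    proof (rule ideal_subring_onI[OF L])
      show "K \<subseteq> B" using Jd(1) by (auto simp: K_def B_def)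
      show "0 \<in> K" using Jd(2) one by (auto simp: K_def Zero_fract_def)
    next
      fix x y assume "x \<in> K" "y \<in> K"
      then obtain g s h t where *: "x = Fract g s" "g \<in> J" "s \<in> A - P"
        "y = Fract h t" "h \<in> J" "t \<in> A - P" unfolding K_def by blast
      have "s \<noteq> 0" "t \<noteq> 0" using * zero by auto
      then have "x + y = Fract (t * g + s * h) (s * t)" using * by (simp add: mult.commute)
      moreover have "t * g + s * h \<in> J" using * Jd(3,4) by auto
      ultimately show "x + y \<in> K" using prime[of s t] * unfolding K_def by blast
    next
      fix x y assume "x \<in> B" "y \<in> K"
      then obtain g s h t where *: "x = Fract g s" "g \<in> A" "s \<in> A - P"
        "y = Fract h t" "h \<in> J" "t \<in> A - P" unfolding K_def B_def by blast
      have "x * y = Fract (g * h) (s * t)" using * by simp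
      moreover have "g * h \<in> J" using * Jd(4) by auto
      ultimately show "x * y \<in> K" using prime[of s t] * unfolding K_def by blast
    qed
    then have "Idl\<^bsub>subring_on B\<^esub> ((\<lambda>g. Fract g 1) ` J) \<subseteq> K"
      by (rule L.genideal_minimal) (use one in \<open>auto simp: K_def\<close>)
    with l obtain g s where *: "Fract f 1 = Fract g s" "g \<in> J" "s \<in> A - P"
      unfolding K_def by blast
    have "s \<noteq> 0" using * zero by auto
    with * have "s * f = g" by (simp add: eq_fract mult.commute)
    then show "\<exists>s\<in>A - P. s * f \<in> J" using * by blast
  next
    assume "\<exists>s\<in>A - P. s * f \<in> J"
    then obtain s where s: "s \<in> A - P" "s * f \<in> J" by blast
    then have "s \<noteq> 0" using zero by auto
    have "Fract (s * f) 1 \<in> Idl\<^bsub>subring_on B\<^esub> ((\<lambda>g. Fract g 1) ` J)"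
      using L.genideal_self[OF sub] s by blast
    moreover have "Fract 1 s \<in> B" using s one by (auto simp: B_def)
    ultimately have "Fract 1 s * Fract (s * f) 1 \<in> Idl\<^bsub>subring_on B\<^esub> ((\<lambda>g. Fract g 1) ` J)"
      using ideal_subring_onD(4)[OF L.genideal_ideal[OF sub]] by blast
    moreover have "Fract 1 s * Fract (s * f) 1 = Fract f 1"
      using \<open>s \<noteq> 0\<close> by (simp add: eq_fract)
    ultimately show "Fract f 1 \<in> Idl\<^bsub>subring_on B\<^esub> ((\<lambda>g. Fract g 1) ` J)" by simp
  qed
qed

section \<open>Symbolic powers of edge ideals\<close>

definition mpolys :: "'v set \<Rightarrow> (('v \<Rightarrow>\<^sub>0 nat) \<Rightarrow>\<^sub>0 'a::comm_ring_1) set"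
  where "mpolys V = {p. \<forall>t\<in>Poly_Mapping.keys p. Poly_Mapping.keys t \<subseteq> V}"

lemma mpoly_ring_eq_subring_on: "mpoly_ring V = subring_on (mpolys V)"
  by (simp add: mpoly_ring_def mpolys_def)

lemma cring_mpolys: "cring (subring_on (mpolys V))"
  using cring_mpoly_ring[of V] by (simp add: mpoly_ring_eq_subring_on)

lemma mpolys_closed:
  "0 \<in> mpolys V" "p \<in> mpolys V \<Longrightarrow> q \<in> mpolys V \<Longrightarrow> p + q \<in> mpolys V"
  "p \<in> mpolys V \<Longrightarrow> q \<in> mpolys V \<Longrightarrow> p * q \<in> mpolys V"
proof -
  interpret cring "subring_on (mpolys V)" by (rule cring_mpolys)
  show "0 \<in> mpolys V" by (simp add: mpolys_def)
  show "p \<in> mpolys V \<Longrightarrow> q \<in> mpolys V \<Longrightarrow> p + q \<in> mpolys V" using a_closed[of p q] by simp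
  show "p \<in> mpolys V \<Longrightarrow> q \<in> mpolys V \<Longrightarrow> p * q \<in> mpolys V" using m_closed[of p q] by simp
qed

lemma single_mem_mpolys: "Poly_Mapping.keys t \<subseteq> V \<Longrightarrow> Poly_Mapping.single t c \<in> mpolys V"
  by (auto simp: mpolys_def)

lemma lookup_sum_singles:
  fixes c :: "'b \<Rightarrow> 'a::comm_monoid_add"
  assumes "finite S"
  shows "Poly_Mapping.lookup (\<Sum>t\<in>S. Poly_Mapping.single t (c t)) u = (if u \<in> S then c u else 0)"
  using assms by (simp add: lookup_sum lookup_single when_def)

lemma poly_mapping_eq_sum_singles:
  fixes f :: "'b \<Rightarrow>\<^sub>0 'a::comm_monoid_add"
  shows "f = (\<Sum>t\<in>Poly_Mapping.keys f. Poly_Mapping.single t (Poly_Mapping.lookup f t))"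
  by (rule poly_mapping_eqI) (simp add: lookup_sum_singles in_keys_iff)

lemma poly_mapping_split:
  fixes f :: "'b \<Rightarrow>\<^sub>0 'a::comm_monoid_add"
  obtains g h where "f = g + h" "Poly_Mapping.keys g = {t \<in> Poly_Mapping.keys f. P t}"
    "Poly_Mapping.keys h = {t \<in> Poly_Mapping.keys f. \<not> P t}"
proof
  let ?s = "\<lambda>t. Poly_Mapping.single t (Poly_Mapping.lookup f t)"
  let ?g = "\<Sum>t | t \<in> Poly_Mapping.keys f \<and> P t. ?s t"
  let ?h = "\<Sum>t | t \<in> Poly_Mapping.keys f \<and> \<not> P t. ?s t"
  show "f = ?g + ?h"
    by (rule poly_mapping_eqI) (auto simp: lookup_add lookup_sum_singles in_keys_iff)
  show "Poly_Mapping.keys ?g = {t \<in> Poly_Mapping.keys f. P t}"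
    "Poly_Mapping.keys ?h = {t \<in> Poly_Mapping.keys f. \<not> P t}"
    by (auto simp: in_keys_iff lookup_sum_singles split: if_splits)
qed

text \<open>Multiplication by a monomial translates exponents injectively, so no terms merge or
  cancel. This makes colon ideals by monomials computable.\<close>

lemma keys_single_mult:
  fixes f :: "'b::cancel_comm_monoid_add \<Rightarrow>\<^sub>0 'a::comm_semiring_1"
  shows "Poly_Mapping.keys (Poly_Mapping.single u 1 * f) = (+) u ` Poly_Mapping.keys f"
proof -
  have "Poly_Mapping.single u 1 * f =
    (\<Sum>t\<in>Poly_Mapping.keys f. Poly_Mapping.single (u + t) (Poly_Mapping.lookup f t))"
    by (subst poly_mapping_eq_sum_singles[of f]) (simp add: sum_distrib_left mult_single)
  also have "\<dots> = (\<Sum>t\<in>(+) u ` Poly_Mapping.keys f.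
      Poly_Mapping.single t (Poly_Mapping.lookup f (t - u)))"
    by (subst sum.reindex) (auto simp: o_def)
  finally show ?thesis
    by (auto simp: in_keys_iff lookup_sum_singles split: if_splits)
qed

text \<open>Natural exponents cannot cancel, which turns the inclusion
  \<open>Poly_Mapping.keys_add\<close> into an equality.\<close>

lemma keys_add_nat:
  fixes s t :: "'v \<Rightarrow>\<^sub>0 nat"
  shows "Poly_Mapping.keys (s + t) = Poly_Mapping.keys s \<union> Poly_Mapping.keys t"
  by (auto simp: in_keys_iff lookup_add)

lemma mem_ideal_of_monomials:
  fixes f :: "('v \<Rightarrow>\<^sub>0 nat) \<Rightarrow>\<^sub>0 'a::comm_ring_1"
  assumes J: "ideal J (subring_on (mpolys V))" and f: "f \<in> mpolys V"
    and keys: "\<And>t. t \<in> Poly_Mapping.keys f \<Longrightarrow> Poly_Mapping.single t 1 \<in> J"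
  shows "f \<in> J"
proof -
  have "(\<Sum>t\<in>S. Poly_Mapping.single t (Poly_Mapping.lookup f t)) \<in> J"
    if "finite S" "S \<subseteq> Poly_Mapping.keys f" for S
    using that
  proof (induction S rule: finite_induct)
    case empty
    then show ?case using ideal_subring_onD(2)[OF J] by simp
  next
    case (insert t S)
    have "Poly_Mapping.single 0 (Poly_Mapping.lookup f t) * Poly_Mapping.single t 1 \<in> J"
      using insert keys by (intro ideal_subring_onD(4)[OF J]) (auto intro: single_mem_mpolys)
    then show ?case
      using insert ideal_subring_onD(3)[OF J] by (simp add: mult_single)
  qed
  then show ?thesis
    using poly_mapping_eq_sum_singles[of f] by (metis finite_keys order_refl)
qed

lemma single_mem_ideal_mono:
  fixes t u :: "'v \<Rightarrow>\<^sub>0 nat" and J :: "(('v \<Rightarrow>\<^sub>0 nat) \<Rightarrow>\<^sub>0 'a::comm_ring_1) set"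
  assumes J: "ideal J (subring_on (mpolys V))" and u: "Poly_Mapping.single u 1 \<in> J"
    and t: "Poly_Mapping.keys t \<subseteq> V"
    and le: "\<And>i. Poly_Mapping.lookup u i \<le> Poly_Mapping.lookup t i"
  shows "Poly_Mapping.single t 1 \<in> J"
proof -
  have "t = (t - u) + u"
    by (rule poly_mapping_eqI) (use le in \<open>simp add: lookup_add lookup_minus\<close>)
  then have "Poly_Mapping.single t (1::'a) = Poly_Mapping.single (t - u) 1 * Poly_Mapping.single u 1"
    by (metis mult_single mult_1)
  moreover have "Poly_Mapping.keys (t - u) \<subseteq> V"
    using t by (auto simp: in_keys_iff lookup_minus)
  ultimately show ?thesis
    using ideal_subring_onD(4)[OF J _ u] single_mem_mpolys by metis
qed

lemma prod_single:
  "finite S \<Longrightarrow> (\<Prod>j\<in>S. Poly_Mapping.single (u j) (1::'a::comm_ring_1)) =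
    Poly_Mapping.single (\<Sum>j\<in>S. u j :: 'b::comm_monoid_add) 1"
  by (induction S rule: finite_induct) (simp_all add: mult_single)

lemma mvar_power: "mvar i ^ k = Poly_Mapping.single (Poly_Mapping.single i k) 1"
  by (induction k) (simp_all add: mvar_def mult_single flip: single_add)

section \<open>Ideals defined by the degree in a set of variables\<close>

definition weight :: "'v set \<Rightarrow> ('v \<Rightarrow>\<^sub>0 nat) \<Rightarrow> nat"
  where "weight W t = (\<Sum>i\<in>W. Poly_Mapping.lookup t i)"

text \<open>For finite \<open>W\<close> inside \<open>V\<close> this is the m-th power of the ideal
  generated by the variables in \<open>W\<close>, described by supports instead of
  generators.\<close>

definition weight_ideal :: "'v set \<Rightarrow> 'v set \<Rightarrow> nat \<Rightarrow> (('v \<Rightarrow>\<^sub>0 nat) \<Rightarrow>\<^sub>0 'a::comm_ring_1) set"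
  where "weight_ideal V W m = {f \<in> mpolys V. \<forall>t\<in>Poly_Mapping.keys f. m \<le> weight W t}"

lemma weight_add: "weight W (s + t) = weight W s + weight W t"
  by (simp add: weight_def lookup_add sum.distrib)

lemma weight_ideal_add:
  "f \<in> weight_ideal V W m \<Longrightarrow> g \<in> weight_ideal V W m \<Longrightarrow> f + g \<in> weight_ideal V W m"
  using Poly_Mapping.keys_add[of f g] by (auto simp: weight_ideal_def mpolys_closed)

lemma weight_ideal_mult:
  assumes "f \<in> weight_ideal V W k" "g \<in> weight_ideal V W m"
  shows "f * g \<in> weight_ideal V W (k + m)"
  using assms Poly_Mapping.keys_mult[of f g]
  by (fastforce simp: weight_ideal_def mpolys_closed weight_add intro: add_mono)

lemma weight_ideal_0: "weight_ideal V W 0 = mpolys V"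
  by (simp add: weight_ideal_def)

lemma ideal_weight_ideal: "ideal (weight_ideal V W m) (subring_on (mpolys V))"
proof (rule ideal_subring_onI[OF cring_mpolys])
  show "weight_ideal V W m \<subseteq> mpolys V" "0 \<in> weight_ideal V W m"
    by (auto simp: weight_ideal_def mpolys_closed)
  show "a * f \<in> weight_ideal V W m" if "a \<in> mpolys V" "f \<in> weight_ideal V W m" for a f
    using weight_ideal_mult[of a V W 0 f m] that by (simp add: weight_ideal_0)
qed (rule weight_ideal_add)

text \<open>Compares the parts of least weight of \<open>s\<close> and \<open>f\<close>, whose product does not
  vanish.\<close>

lemma weight_ideal_cancel:
  fixes s f :: "('v::linorder \<Rightarrow>\<^sub>0 nat) \<Rightarrow>\<^sub>0 'a::idom"
  assumes f: "f \<in> mpolys V" and s: "u \<in> Poly_Mapping.keys s" "weight W u = 0"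
    and sf: "s * f \<in> weight_ideal V W m"
  shows "f \<in> weight_ideal V W m"
proof (rule ccontr)
  assume "f \<notin> weight_ideal V W m"
  then obtain t0 where t0: "t0 \<in> Poly_Mapping.keys f" "weight W t0 < m"
    using f by (auto simp: weight_ideal_def not_le)
  define d where "d = Min (weight W ` Poly_Mapping.keys f)"
  have d_le: "d \<le> weight W t" if "t \<in> Poly_Mapping.keys f" for t
    unfolding d_def using that by (intro Min_le) auto
  have "d \<in> weight W ` Poly_Mapping.keys f"
    unfolding d_def using t0 by (intro Min_in) auto
  then obtain t1 where t1: "t1 \<in> Poly_Mapping.keys f" "weight W t1 = d" by auto
  obtain f0 f1 where f01: "f = f0 + f1"
    "Poly_Mapping.keys f0 = {t \<in> Poly_Mapping.keys f. weight W t = d}"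
    "Poly_Mapping.keys f1 = {t \<in> Poly_Mapping.keys f. weight W t \<noteq> d}"
    by (rule poly_mapping_split)
  obtain s0 s1 where s01: "s = s0 + s1"
    "Poly_Mapping.keys s0 = {t \<in> Poly_Mapping.keys s. weight W t = 0}"
    "Poly_Mapping.keys s1 = {t \<in> Poly_Mapping.keys s. weight W t \<noteq> 0}"
    by (rule poly_mapping_split)
  have "f0 \<noteq> 0" "s0 \<noteq> 0" using f01(2) s01(2) s t1 by auto
  \<comment> \<open>The polynomial ring has no zero divisors: the linear order on the variables
    induces one on the monomials.\<close>
  then have "s0 * f0 \<noteq> 0" by simp
  then obtain t where t: "t \<in> Poly_Mapping.keys (s0 * f0)" by (metis ex_in_conv keys_eq_empty)
  have t_wt: "weight W t = d"
    using t Poly_Mapping.keys_mult[of s0 f0] f01(2) s01(2) by (auto simp: weight_add)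
  have "weight W t' > d" if "t' \<in> Poly_Mapping.keys (s0 * f1)" for t'
    using that Poly_Mapping.keys_mult[of s0 f1] f01(3) d_le
    by (fastforce simp: weight_add)
  moreover have "weight W t' > d" if t': "t' \<in> Poly_Mapping.keys (s1 * f)" for t'
  proof -
    obtain a b where "t' = a + b" "a \<in> Poly_Mapping.keys s1" "b \<in> Poly_Mapping.keys f"
      using t' Poly_Mapping.keys_mult[of s1 f] by blast
    then show ?thesis using s01(3) d_le[of b] by (auto simp: weight_add)
  qed
  ultimately have "t \<notin> Poly_Mapping.keys (s0 * f1) \<union> Poly_Mapping.keys (s1 * f)"
    using t_wt by blast
  then have "t \<notin> Poly_Mapping.keys (s0 * f1 + s1 * f)"
    using Poly_Mapping.keys_add[of "s0 * f1" "s1 * f"] by blast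
  moreover have "s * f = s0 * f0 + (s0 * f1 + s1 * f)"
    using f01(1) s01(1) by (simp add: algebra_simps)
  ultimately have "t \<in> Poly_Mapping.keys (s * f)"
    using t by (simp add: in_keys_iff lookup_add)
  then show False
    using sf t_wt d_le[OF t0(1)] t0(2) by (auto simp: weight_ideal_def)
qed

section \<open>Edge ideals of finite graphs and their symbolic powers\<close>

definition vertex_cover :: "'v set \<Rightarrow> 'v set set \<Rightarrow> 'v set \<Rightarrow> bool"
  where "vertex_cover V E W \<longleftrightarrow> W \<subseteq> V \<and> (\<forall>e\<in>E. e \<inter> W \<noteq> {})"

locale finite_graph =
  fixes V :: "'v::linorder set" and E :: "'v set set"
  assumes finite_V: "finite V"
    and edge_sub: "e \<in> E \<Longrightarrow> e \<subseteq> V"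
    and edge_card: "e \<in> E \<Longrightarrow> card e = 2"
begin

lemma mvar_mult: "mvar i * mvar j = Poly_Mapping.single (Poly_Mapping.single i 1 + Poly_Mapping.single j 1) 1"
  by (simp add: mvar_def mult_single)

lemma edge_doubleton:
  assumes "e \<in> E"
  obtains i j where "e = {i, j}" "i \<noteq> j"
  using edge_card[OF assms] by (auto simp: card_2_iff)

lemma generators_sub: "{mvar i * mvar j |i j. {i, j} \<in> E} \<subseteq> mpolys V"
proof clarify
  fix i j assume "{i, j} \<in> E"
  then show "mvar i * mvar j \<in> mpolys V"
    using edge_sub[of "{i, j}"] by (auto simp: mvar_mult keys_add_nat intro!: single_mem_mpolys)
qed

lemma ideal_edge_ideal: "ideal (edge_ideal V E) (subring_on (mpolys V))"
  unfolding edge_ideal_def mpoly_ring_eq_subring_on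
  using ring.genideal_ideal[OF cring.axioms(1)[OF cring_mpolys]] generators_sub by simp

lemma edge_mem_edge_ideal: "{i, j} \<in> E \<Longrightarrow> mvar i * mvar j \<in> edge_ideal V E"
  unfolding edge_ideal_def mpoly_ring_eq_subring_on
  using ring.genideal_self[OF cring.axioms(1)[OF cring_mpolys], of "{mvar i * mvar j |i j. {i, j} \<in> E}" V]
    generators_sub by auto

text \<open>A monomial ideal can be tested term by term. As the two ends of an edge are distinct,
  divisibility by the edge monomial depends on the support of a term only.\<close>

lemma mem_edge_ideal_iff:
  fixes f :: "('v \<Rightarrow>\<^sub>0 nat) \<Rightarrow>\<^sub>0 'a::comm_ring_1"
  shows
  "f \<in> edge_ideal V E \<longleftrightarrow> f \<in> mpolys V \<and> (\<forall>t\<in>Poly_Mapping.keys f. \<exists>e\<in>E. e \<subseteq> Poly_Mapping.keys t)"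
proof
  define M :: "(('v \<Rightarrow>\<^sub>0 nat) \<Rightarrow>\<^sub>0 'a) set"
    where "M = {f \<in> mpolys V. \<forall>t\<in>Poly_Mapping.keys f. \<exists>e\<in>E. e \<subseteq> Poly_Mapping.keys t}"
  have "ideal M (subring_on (mpolys V))"
  proof (rule ideal_subring_onI[OF cring_mpolys])
    show "M \<subseteq> mpolys V" "0 \<in> M" by (auto simp: M_def mpolys_closed)
    show "f + g \<in> M" if "f \<in> M" "g \<in> M" for f g
      using that Poly_Mapping.keys_add[of f g] unfolding M_def
      by (blast intro: mpolys_closed)
    show "a * f \<in> M" if "a \<in> mpolys V" "f \<in> M" for a f
    proof -
      have "\<exists>e\<in>E. e \<subseteq> Poly_Mapping.keys t" if t: "t \<in> Poly_Mapping.keys (a * f)" for t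
      proof -
        obtain u v where "t = u + v" "v \<in> Poly_Mapping.keys f"
          using t Poly_Mapping.keys_mult[of a f] by blast
        moreover from this obtain e where "e \<in> E" "e \<subseteq> Poly_Mapping.keys v"
          using \<open>f \<in> M\<close> unfolding M_def by blast
        ultimately show ?thesis by (auto simp: keys_add_nat)
      qed
      then show ?thesis using that by (auto simp: M_def mpolys_closed)
    qed
  qed
  moreover have "{mvar i * mvar j |i j. {i, j} \<in> E} \<subseteq> M"
  proof clarify
    fix i j assume ij: "{i, j} \<in> E"
    then have "mvar i * mvar j \<in> mpolys V" using generators_sub by blast
    then show "mvar i * mvar j \<in> M"
      using bexI[where x = "{i, j}" and A = E, OF _ ij] by (auto simp: M_def mvar_mult keys_add_nat)
  qed
  ultimately have "edge_ideal V E \<subseteq> M"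
    unfolding edge_ideal_def mpoly_ring_eq_subring_on
    by (rule ring.genideal_minimal[OF cring.axioms(1)[OF cring_mpolys]])
  moreover assume "f \<in> edge_ideal V E"
  ultimately show "f \<in> mpolys V \<and> (\<forall>t\<in>Poly_Mapping.keys f. \<exists>e\<in>E. e \<subseteq> Poly_Mapping.keys t)"
    by (auto simp: M_def)
next
  assume f: "f \<in> mpolys V \<and> (\<forall>t\<in>Poly_Mapping.keys f. \<exists>e\<in>E. e \<subseteq> Poly_Mapping.keys t)"
  show "f \<in> edge_ideal V E"
  proof (rule mem_ideal_of_monomials[OF ideal_edge_ideal])
    fix t assume t: "t \<in> Poly_Mapping.keys f"
    then obtain e where e: "e \<in> E" "e \<subseteq> Poly_Mapping.keys t" using f by blast
    obtain i j where ij: "e = {i, j}" "i \<noteq> j" using edge_doubleton[OF e(1)] .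
    show "Poly_Mapping.single t 1 \<in> edge_ideal V E"
    proof (rule single_mem_ideal_mono[OF ideal_edge_ideal])
      show "Poly_Mapping.single (Poly_Mapping.single i 1 + Poly_Mapping.single j 1) 1 \<in> edge_ideal V E"
        using edge_mem_edge_ideal[of i j] e ij by (simp add: mvar_mult)
      show "Poly_Mapping.keys t \<subseteq> V" using f t by (auto simp: mpolys_def)
      show "Poly_Mapping.lookup (Poly_Mapping.single i 1 + Poly_Mapping.single j 1) k \<le> Poly_Mapping.lookup t k" for k
        using e ij by (auto simp: lookup_add lookup_single when_def in_keys_iff Suc_le_eq)
    qed
  qed (use f in blast)
qed

text \<open>Every edge contributes at least \<open>c\<close> to the weight on \<open>W\<close>, and
  weights add up under multiplication. The case \<open>c = 1\<close> serves vertex covers;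
  \<open>c = 2\<close> with \<open>W = V\<close> bounds the total degree.\<close>

lemma edge_ideal_pow_sub_weight_ideal:
  assumes W: "W \<subseteq> V" and c: "\<And>e. e \<in> E \<Longrightarrow> c \<le> card (e \<inter> W)"
  shows "edge_ideal V E [^]\<^bsub>ideals_set (subring_on (mpolys V))\<^esub> m \<subseteq> weight_ideal V W (m * c)"
proof (rule ideal_pow_subset_filtration)
  fix k and x y :: "('v \<Rightarrow>\<^sub>0 nat) \<Rightarrow>\<^sub>0 'a"
  assume x: "x \<in> weight_ideal V W (k * c)" and y: "y \<in> edge_ideal V E"
  have "c \<le> weight W t" if t: "t \<in> Poly_Mapping.keys y" for t
  proof -
    obtain e where e: "e \<in> E" "e \<subseteq> Poly_Mapping.keys t"
      using y t by (auto simp: mem_edge_ideal_iff)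
    have "c \<le> (\<Sum>i\<in>e \<inter> W. 1)" using c[OF e(1)] by simp
    also have "\<dots> \<le> (\<Sum>i\<in>e \<inter> W. Poly_Mapping.lookup t i)"
      using e(2) by (intro sum_mono) (auto simp: in_keys_iff Suc_le_eq)
    also have "\<dots> \<le> weight W t"
      unfolding weight_def using W finite_V finite_subset by (intro sum_mono2) auto
    finally show ?thesis .
  qed
  then have "y \<in> weight_ideal V W c" using y by (simp add: weight_ideal_def mem_edge_ideal_iff)
  from weight_ideal_mult[OF x this] show "x * y \<in> weight_ideal V W (Suc k * c)"
    by (simp add: add.commute)
qed (auto simp: weight_ideal_0 intro: weight_ideal_add)

text \<open>The prime is the colon ideal of the edge ideal by the product of all variables outside
  \<open>W\<close>. That product is divisible by no edge monomial, and minimality of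
  \<open>W\<close> ensures that multiplying it by any variable of \<open>W\<close> completes an
  edge.\<close>

lemma cover_ideal_mem_Ass:
  assumes W: "vertex_cover V E W" and minimal: "\<And>U. vertex_cover V E U \<Longrightarrow> U \<subseteq> W \<Longrightarrow> U = W"
  shows "(weight_ideal V W 1 :: (('v \<Rightarrow>\<^sub>0 nat) \<Rightarrow>\<^sub>0 'a::idom) set) \<in> Ass (mpoly_ring V) (edge_ideal V E)"
proof -
  let ?P = "weight_ideal V W 1 :: (('v \<Rightarrow>\<^sub>0 nat) \<Rightarrow>\<^sub>0 'a) set"
  have fin: "finite W" "W \<subseteq> V" using W finite_V finite_subset by (auto simp: vertex_cover_def)
  have weight_0: "weight W t = 0 \<longleftrightarrow> Poly_Mapping.keys t \<inter> W = {}" for t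
    using fin by (auto simp: weight_def in_keys_iff)
  have "primeideal ?P (subring_on (mpolys V))"
  proof (rule primeidealI[OF ideal_weight_ideal cring_mpolys])
    have "(1 :: ('v \<Rightarrow>\<^sub>0 nat) \<Rightarrow>\<^sub>0 'a) \<in> mpolys V" "1 \<notin> ?P"
      by (auto simp: mpolys_def weight_ideal_def weight_def)
    then show "carrier (subring_on (mpolys V)) \<noteq> ?P" by auto
  next
    fix a b assume ab: "a \<in> carrier (subring_on (mpolys V))" "b \<in> carrier (subring_on (mpolys V))"
      "a \<otimes>\<^bsub>subring_on (mpolys V)\<^esub> b \<in> ?P"
    show "a \<in> ?P \<or> b \<in> ?P"
    proof (cases "a \<in> ?P")
      case False
      then obtain u where "u \<in> Poly_Mapping.keys a" "weight W u = 0"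
        using ab(1) by (auto simp: weight_ideal_def Suc_le_eq)
      then show ?thesis using weight_ideal_cancel[of b V u a W 1] ab by simp
    qed simp
  qed
  moreover define u where "u = (\<Sum>i\<in>V - W. Poly_Mapping.single i (1::nat))"
  have keys_u: "Poly_Mapping.keys u = V - W"
    using finite_V by (auto simp: u_def in_keys_iff lookup_sum_singles split: if_splits)
  define f :: "('v \<Rightarrow>\<^sub>0 nat) \<Rightarrow>\<^sub>0 'a" where "f = Poly_Mapping.single u 1"
  have f: "f \<in> mpolys V" using keys_u by (auto simp: f_def intro: single_mem_mpolys)
  moreover have "?P = {g \<in> mpolys V. g * f \<in> edge_ideal V E}"
  proof (rule Set.set_eqI)
    fix g :: "('v \<Rightarrow>\<^sub>0 nat) \<Rightarrow>\<^sub>0 'a"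
    have span: "(\<exists>e\<in>E. e \<subseteq> Poly_Mapping.keys (u + t)) \<longleftrightarrow> 1 \<le> weight W t"
      if t: "Poly_Mapping.keys t \<subseteq> V" for t
    proof
      assume "\<exists>e\<in>E. e \<subseteq> Poly_Mapping.keys (u + t)"
      then have "Poly_Mapping.keys t \<inter> W \<noteq> {}"
        using W unfolding vertex_cover_def keys_add_nat keys_u by blast
      then show "1 \<le> weight W t" using weight_0 by (metis less_one not_le)
    next
      assume "1 \<le> weight W t"
      then obtain i where i: "i \<in> Poly_Mapping.keys t" "i \<in> W" using weight_0[of t] by auto
      \<comment> \<open>Without \<open>i\<close> the set no longer covers, so some edge meets
        \<open>W\<close> in \<open>i\<close> alone; its other end divides the product of the
        variables outside \<open>W\<close>.\<close>
      have "\<not> vertex_cover V E (W - {i})" using minimal[of "W - {i}"] i by auto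
      then obtain e where e: "e \<in> E" "e \<inter> W \<subseteq> {i}"
        using fin by (auto simp: vertex_cover_def)
      then have "e \<subseteq> Poly_Mapping.keys (u + t)"
        using i edge_sub by (auto simp: keys_add_nat keys_u)
      with e show "\<exists>e\<in>E. e \<subseteq> Poly_Mapping.keys (u + t)" by blast
    qed
    have "g * f \<in> edge_ideal V E \<longleftrightarrow> (\<forall>t\<in>Poly_Mapping.keys g. 1 \<le> weight W t)" if g: "g \<in> mpolys V"
    proof -
      have "g * f \<in> edge_ideal V E \<longleftrightarrow>
          (\<forall>t\<in>Poly_Mapping.keys g. \<exists>e\<in>E. e \<subseteq> Poly_Mapping.keys (u + t))"
        using mpolys_closed(3)[OF g f]
        by (simp add: mem_edge_ideal_iff f_def mult.commute[of g] keys_single_mult)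
      then show ?thesis using g span by (auto simp: mpolys_def)
    qed
    then show "g \<in> ?P \<longleftrightarrow> g \<in> {g \<in> mpolys V. g * f \<in> edge_ideal V E}"
      by (auto simp: weight_ideal_def)
  qed
  ultimately show ?thesis
    by (auto simp: Ass_def mpoly_ring_eq_subring_on)
qed

text \<open>This is all that is extracted from an arbitrary associated prime, which is never shown
  to be generated by variables. For the second claim, write \<open>P\<close> as the colon ideal by
  \<open>f\<close> and choose a term of \<open>f\<close> whose support contains no edge. A variable
  of \<open>P\<close> must complete an edge with that support, and the other end of this edge is the
  neighbour sought.\<close>

lemma Ass_edge_ideal_variables:
  fixes P :: "(('v \<Rightarrow>\<^sub>0 nat) \<Rightarrow>\<^sub>0 'a::idom) set"
  assumes P: "P \<in> Ass (mpoly_ring V) (edge_ideal V E)"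
  shows "vertex_cover V E {i \<in> V. mvar i \<in> P}"
    and "i \<in> V \<Longrightarrow> mvar i \<in> P \<Longrightarrow> \<exists>j\<in>V. {i, j} \<in> E \<and> mvar j \<notin> P"
proof -
  let ?I = "edge_ideal V E :: (('v \<Rightarrow>\<^sub>0 nat) \<Rightarrow>\<^sub>0 'a) set"
  obtain f where f: "f \<in> mpolys V" "P = {g \<in> mpolys V. g * f \<in> ?I}"
    using P by (auto simp: Ass_def mpoly_ring_eq_subring_on)
  interpret P: primeideal P "subring_on (mpolys V)"
    using P by (auto simp: Ass_def mpoly_ring_eq_subring_on)
  have mvar_mem: "mvar i \<in> mpolys V" if "i \<in> V" for i
    unfolding mvar_def using that by (intro single_mem_mpolys) simp
  show "vertex_cover V E {i \<in> V. mvar i \<in> P}"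
    unfolding vertex_cover_def
  proof (intro conjI ballI)
    fix e assume e: "e \<in> E"
    obtain i j where ij: "e = {i, j}" using edge_doubleton[OF e] .
    have iV: "i \<in> V" "j \<in> V" using edge_sub[OF e] ij by auto
    have "f * (mvar i * mvar j) \<in> ?I"
      using ideal_subring_onD(4)[OF ideal_edge_ideal f(1)] edge_mem_edge_ideal e ij by blast
    then have "mvar i * mvar j \<in> P"
      using f(2) mpolys_closed(3)[OF mvar_mem mvar_mem, OF iV] by (simp add: mult.commute)
    then have "mvar i \<in> P \<or> mvar j \<in> P" using P.I_prime[of "mvar i" "mvar j"] mvar_mem[OF iV(1)] mvar_mem[OF iV(2)] by simp
    then show "e \<inter> {i \<in> V. mvar i \<in> P} \<noteq> {}" using ij iV by auto
  qed auto
  assume i: "i \<in> V" "mvar i \<in> P"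
  have "1 \<notin> P" using P.one_imp_carrier P.I_notcarr by auto
  then have "f \<notin> ?I" using f P.one_closed by simp
  then obtain t where t: "t \<in> Poly_Mapping.keys f" "\<And>e. e \<in> E \<Longrightarrow> \<not> e \<subseteq> Poly_Mapping.keys t"
    using f(1) by (auto simp: mem_edge_ideal_iff)
  have span: "\<exists>e\<in>E. e \<subseteq> insert k (Poly_Mapping.keys t)" if "mvar k \<in> P" for k
  proof -
    have "Poly_Mapping.single (Poly_Mapping.single k 1) 1 * f \<in> ?I"
      using that f(2) by (simp add: mvar_def)
    moreover have "Poly_Mapping.single k 1 + t \<in>
        Poly_Mapping.keys (Poly_Mapping.single (Poly_Mapping.single k 1) 1 * f)"
      using t(1) by (simp add: keys_single_mult)
    ultimately obtain e where "e \<in> E" "e \<subseteq> Poly_Mapping.keys (Poly_Mapping.single k 1 + t)"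
      unfolding mem_edge_ideal_iff by blast
    then show ?thesis by (auto simp: keys_add_nat)
  qed
  obtain e where e: "e \<in> E" "e \<subseteq> insert i (Poly_Mapping.keys t)" using span[OF i(2)] by blast
  have "i \<in> e" using e t(2)[OF e(1)] by blast
  then obtain j where j: "e = {i, j}" "i \<noteq> j"
    using edge_doubleton[OF e(1)] by (metis doubleton_eq_iff insertE singletonD)
  then have jt: "j \<in> Poly_Mapping.keys t" using e by auto
  \<comment> \<open>Since \<open>j\<close> already lies in the support of \<open>t\<close>, having
    its variable in \<open>P\<close> would put a whole edge into that support.\<close>
  then have "mvar j \<notin> P" using span[of j] t(2) by (auto simp: insert_absorb)
  then show "\<exists>j\<in>V. {i, j} \<in> E \<and> mvar j \<notin> P" using e j edge_sub by auto
qed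

lemma exists_minimal_vertex_cover:
  assumes "vertex_cover V E W"
  obtains U where "vertex_cover V E U" "U \<subseteq> W" "\<forall>X. vertex_cover V E X \<longrightarrow> X \<subseteq> U \<longrightarrow> X = U"
proof -
  have "finite {U. vertex_cover V E U}"
    by (rule finite_subset[of _ "Pow V"]) (use finite_V in \<open>auto simp: vertex_cover_def\<close>)
  from finite_has_minimal2[OF this, of W] assms obtain U where
    "vertex_cover V E U" "U \<subseteq> W" "\<forall>X\<in>{U. vertex_cover V E U}. X \<subseteq> U \<longrightarrow> U = X" by blast
  then show ?thesis using that[of U] by blast
qed

text \<open>From left to right, localize at the prime of a minimal cover inside \<open>W\<close> and
  cancel the multiplier. From right to left, take the cover formed by the variables in
  \<open>P\<close> and multiply by powers of neighbours that lie outside \<open>P\<close>.\<close>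

lemma mem_symbolic_power_iff:
  fixes f :: "('v \<Rightarrow>\<^sub>0 nat) \<Rightarrow>\<^sub>0 'a::idom"
  shows "f \<in> symbolic_power (mpoly_ring V) (edge_ideal V E) m \<longleftrightarrow>
    f \<in> mpolys V \<and> (\<forall>W. vertex_cover V E W \<longrightarrow> f \<in> weight_ideal V W m)"
proof -
  let ?I = "edge_ideal V E :: (('v \<Rightarrow>\<^sub>0 nat) \<Rightarrow>\<^sub>0 'a) set"
  let ?R = "subring_on (mpolys V) :: (('v \<Rightarrow>\<^sub>0 nat) \<Rightarrow>\<^sub>0 'a) ring"
  have ring: "ring ?R" by (rule cring.axioms(1)[OF cring_mpolys])
  have pow: "ideal (?I [^]\<^bsub>ideals_set ?R\<^esub> m) ?R"
    by (rule ring.ideal_pow_is_ideal[OF ring ideal_edge_ideal])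
  have "f \<in> symbolic_power (mpoly_ring V) ?I m \<longleftrightarrow> f \<in> mpolys V \<and>
      (\<forall>P\<in>Ass ?R ?I. \<exists>s\<in>mpolys V - P. s * f \<in> ?I [^]\<^bsub>ideals_set ?R\<^esub> m)"
    unfolding symbolic_power_def mpoly_ring_eq_subring_on mem_Collect_eq carrier_subring_on
  proof (intro conj_cong refl ball_cong)
    fix P assume "f \<in> mpolys V" "P \<in> Ass ?R ?I"
    then show "(Fract f 1 \<in> Idl\<^bsub>localization ?R P\<^esub>
        ((\<lambda>g. Fract g 1) ` (?I [^]\<^bsub>ideals_set ?R\<^esub> m))) \<longleftrightarrow>
        (\<exists>s\<in>mpolys V - P. s * f \<in> ?I [^]\<^bsub>ideals_set ?R\<^esub> m)"
      by (intro Fract_mem_Idl_localization_iff[OF _ pow]) (simp_all add: Ass_def)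
  qed
  also have "\<dots> \<longleftrightarrow> f \<in> mpolys V \<and> (\<forall>W. vertex_cover V E W \<longrightarrow> f \<in> weight_ideal V W m)"
  proof (intro conj_cong refl iffI allI impI ballI)
    fix W assume f: "f \<in> mpolys V" and W: "vertex_cover V E W"
      and loc: "\<forall>P\<in>Ass ?R ?I. \<exists>s\<in>mpolys V - P. s * f \<in> ?I [^]\<^bsub>ideals_set ?R\<^esub> m"
    obtain U where U: "vertex_cover V E U" "U \<subseteq> W" "\<forall>X. vertex_cover V E X \<longrightarrow> X \<subseteq> U \<longrightarrow> X = U"
      by (rule exists_minimal_vertex_cover[OF W])
    have "weight_ideal V U 1 \<in> Ass ?R ?I"
      using cover_ideal_mem_Ass[OF U(1)] U(3) by (simp add: mpoly_ring_eq_subring_on)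
    then obtain s where s: "s \<in> mpolys V" "s \<notin> weight_ideal V U 1"
      "s * f \<in> ?I [^]\<^bsub>ideals_set ?R\<^esub> m" using loc by blast
    \<comment> \<open>As \<open>s\<close> avoids the prime of \<open>U\<close>, it has a term of
      weight 0 on \<open>U\<close>, as required by \<open>weight_ideal_cancel\<close>.\<close>
    obtain u where u: "u \<in> Poly_Mapping.keys s" "weight U u = 0"
      using s(1,2) by (auto simp: weight_ideal_def Suc_le_eq)
    have "1 \<le> card (e \<inter> U)" if "e \<in> E" for e
      using U(1) that edge_sub[OF that] finite_V finite_subset[of U V]
      by (auto simp: vertex_cover_def Suc_le_eq card_gt_0_iff)
    then have "s * f \<in> weight_ideal V U m"
      using edge_ideal_pow_sub_weight_ideal[of U 1 m] U(1) s(3) by (auto simp: vertex_cover_def)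
    then have "f \<in> weight_ideal V U m" by (rule weight_ideal_cancel[OF f u])
    moreover have "weight U t \<le> weight W t" for t
      unfolding weight_def using U(2) W finite_V finite_subset
      by (intro sum_mono2) (auto simp: vertex_cover_def)
    ultimately show "f \<in> weight_ideal V W m" by (auto simp: weight_ideal_def intro: order_trans)
  next
    fix P assume f: "f \<in> mpolys V" and P: "P \<in> Ass ?R ?I"
      and weights: "\<forall>W. vertex_cover V E W \<longrightarrow> f \<in> weight_ideal V W m"
    interpret P: primeideal P ?R using P by (auto simp: Ass_def)
    note Ass = Ass_edge_ideal_variables[OF P[folded mpoly_ring_eq_subring_on]]
    define W where "W = {i \<in> V. mvar i \<in> P}"
    have fin: "finite W" using finite_V by (simp add: W_def)
    obtain nb where nb: "\<And>i. i \<in> W \<Longrightarrow> nb i \<in> V \<and> {i, nb i} \<in> E \<and> mvar (nb i) \<notin> P"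
      using Ass(2) unfolding W_def by (metis (lifting) mem_Collect_eq)
    \<comment> \<open>Every variable in \<open>P\<close> gets a neighbour outside \<open>P\<close>.
      The m-th powers of these neighbours supply the missing ends of up to \<open>m\<close> edges at
      each vertex of \<open>W\<close>.\<close>
    define s where "s = (\<Prod>i\<in>W. mvar (nb i) ^ m :: ('v \<Rightarrow>\<^sub>0 nat) \<Rightarrow>\<^sub>0 'a)"
    have one: "1 \<in> mpolys V - P" using P.one_imp_carrier P.I_notcarr P.one_closed by auto
    have mult: "a * b \<in> mpolys V - P" if "a \<in> mpolys V - P" "b \<in> mpolys V - P" for a b
      using that P.I_prime[of a b] mpolys_closed(3) by auto
    have power: "a ^ k \<in> mpolys V - P" if "a \<in> mpolys V - P" for a k
      by (induction k) (use one mult that in auto)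
    have s: "s \<in> mpolys V - P"
      unfolding s_def using fin nb
    proof (induction W rule: finite_induct)
      case (insert i W)
      have "mvar (nb i) \<in> mpolys V"
        unfolding mvar_def using insert by (intro single_mem_mpolys) auto
      then have "mvar (nb i) \<in> mpolys V - P" using insert by blast
      from mult[OF power[OF this] insert.IH] show ?case using insert by simp
    qed (use one in simp)
    \<comment> \<open>The colon ideal of I^m by \<open>s\<close>. Being an ideal, it may be tested
      on the terms of \<open>f\<close>.\<close>
    define K where "K = {g \<in> mpolys V. s * g \<in> ?I [^]\<^bsub>ideals_set ?R\<^esub> m}"
    have "ideal K ?R"
    proof (rule ideal_subring_onI[OF cring_mpolys])
      show "K \<subseteq> mpolys V" "0 \<in> K"
        using ideal_subring_onD(2)[OF pow] by (auto simp: K_def mpolys_closed)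
      show "x + y \<in> K" if "x \<in> K" "y \<in> K" for x y
        using that ideal_subring_onD(3)[OF pow, of "s * x" "s * y"]
        by (simp add: K_def mpolys_closed distrib_left)
      show "a * x \<in> K" if "a \<in> mpolys V" "x \<in> K" for a x
        using that ideal_subring_onD(4)[OF pow, of a "s * x"]
        by (simp add: K_def mpolys_closed mult.left_commute)
    qed
    then have "f \<in> K"
    proof (rule mem_ideal_of_monomials[OF _ f])
      fix t assume t: "t \<in> Poly_Mapping.keys f"
      \<comment> \<open>The number of edges from \<open>i\<close> to \<open>nb i\<close> to be used.
        The cap \<open>m\<close> keeps the demand on each neighbour within the exponent provided by
        \<open>s\<close>.\<close>
      define k where "k i = min m (Poly_Mapping.lookup t i)" for i
      have tV: "Poly_Mapping.keys t \<subseteq> V" using f t by (auto simp: mpolys_def)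
      have "m \<le> weight W t" using weights Ass(1) t by (auto simp: W_def weight_ideal_def)
      \<comment> \<open>The cap is harmless: a vertex that reaches it yields \<open>m\<close> edges
        alone, and otherwise \<open>k\<close> agrees with \<open>t\<close> on
        \<open>W\<close>.\<close>
      have "m \<le> (\<Sum>i\<in>W. k i)"
      proof (cases "\<exists>i\<in>W. m \<le> Poly_Mapping.lookup t i")
        case True
        then obtain i where i: "i \<in> W" "k i = m" by (auto simp: k_def)
        then show ?thesis using sum.remove[OF fin i(1), of k] by simp
      next
        case False
        then have "(\<Sum>i\<in>W. k i) = weight W t"
          unfolding weight_def by (intro sum.cong) (auto simp: k_def)
        with \<open>m \<le> weight W t\<close> show ?thesis by simp
      qed
      moreover have "(\<Prod>i\<in>W. (mvar i * mvar (nb i)) ^ k i) \<in> ?I [^]\<^bsub>ideals_set ?R\<^esub> (\<Sum>i\<in>W. k i)"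
        using nb edge_mem_edge_ideal by (intro prod_power_mem_ideal_pow cring_mpolys fin) blast
      ultimately have mem: "(\<Prod>i\<in>W. (mvar i * mvar (nb i)) ^ k i) \<in> ?I [^]\<^bsub>ideals_set ?R\<^esub> m"
        using ideal_pow_antimono[OF cring_mpolys ideal_edge_ideal] by blast
      define u where "u = (\<Sum>i\<in>W. Poly_Mapping.single i (k i) + Poly_Mapping.single (nb i) (k i))"
      have u: "(\<Prod>i\<in>W. (mvar i * mvar (nb i)) ^ k i) = (Poly_Mapping.single u 1 :: ('v \<Rightarrow>\<^sub>0 nat) \<Rightarrow>\<^sub>0 'a)"
        unfolding u_def using fin
        by (simp add: prod_single[symmetric] power_mult_distrib mvar_power mult_single)
      define v where "v = (\<Sum>i\<in>W. Poly_Mapping.single (nb i) m)"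
      have v: "s = Poly_Mapping.single v 1"
        unfolding s_def v_def using fin by (simp add: mvar_power prod_single)
      have "Poly_Mapping.single (v + t) 1 \<in> ?I [^]\<^bsub>ideals_set ?R\<^esub> m"
      proof (rule single_mem_ideal_mono[OF pow mem[unfolded u]])
        have "Poly_Mapping.keys v \<subseteq> V"
          using nb Poly_Mapping.keys_sum[of "\<lambda>i. Poly_Mapping.single (nb i) m" W]
          by (fastforce simp: v_def split: if_splits)
        then show "Poly_Mapping.keys (v + t) \<subseteq> V" using tV by (simp add: keys_add_nat)
        fix j
        \<comment> \<open>Of the two ends of each chosen edge, the one in \<open>W\<close> is
          charged to \<open>t\<close> and the neighbour to \<open>v\<close>. Neighbours may
          coincide, so their contributions are compared as sums.\<close>
        have "Poly_Mapping.lookup u j =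
          (\<Sum>i\<in>W. Poly_Mapping.lookup (Poly_Mapping.single i (k i)) j) +
          (\<Sum>i\<in>W. Poly_Mapping.lookup (Poly_Mapping.single (nb i) (k i)) j)"
          by (simp add: u_def lookup_sum lookup_add sum.distrib)
        also have "(\<Sum>i\<in>W. Poly_Mapping.lookup (Poly_Mapping.single i (k i)) j) \<le> Poly_Mapping.lookup t j"
          using fin by (simp add: lookup_single when_def k_def)
        also have "(\<Sum>i\<in>W. Poly_Mapping.lookup (Poly_Mapping.single (nb i) (k i)) j) \<le> Poly_Mapping.lookup v j"
          unfolding v_def lookup_sum by (intro sum_mono) (simp add: lookup_single when_def k_def)
        finally show "Poly_Mapping.lookup u j \<le> Poly_Mapping.lookup (v + t) j"
          by (simp add: lookup_add)
      qed
      then show "Poly_Mapping.single t 1 \<in> K"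
        using tV by (simp add: K_def v mult_single single_mem_mpolys)
    qed
    then show "\<exists>s\<in>mpolys V - P. s * f \<in> ?I [^]\<^bsub>ideals_set ?R\<^esub> m"
      using s by (auto simp: K_def)
  qed
  finally show ?thesis .
qed

end

section \<open>Matchings and covers of the odd cycle\<close>

text \<open>A weighted Koenig theorem for the path on 1, ..., N: \<open>y j\<close> is the
  multiplicity of the edge from \<open>j\<close> to \<open>Suc j\<close>, and \<open>b\<close> gives
  the capacities. The values 0 at indices 0 and \<open>N\<close> stand for the absent edges beyond
  the ends. The proof is greedy at the last vertex, which is a leaf.\<close>

lemma path_koenig:
  fixes b :: "nat \<Rightarrow> nat"
  assumes "N \<ge> 1"
  shows "\<exists>y W. W \<subseteq> {1..N} \<and> (\<forall>j\<in>{1..<N}. j \<in> W \<or> Suc j \<in> W) \<and> y 0 = 0 \<and> y N = 0 \<and>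
    (\<forall>j\<in>{1..N}. y (j - 1) + y j \<le> b j) \<and> (\<Sum>j=1..<N. y j) = (\<Sum>j\<in>W. b j)"
  using assms
proof (induction N arbitrary: b rule: dec_induct)
  case base
  show ?case by (intro exI[of _ "\<lambda>_. 0"] exI[of _ "{}"]) simp
next
  case (step N)
  \<comment> \<open>The last edge is used as often as possible, and the capacity of \<open>N\<close>
    is lowered accordingly before the induction hypothesis is applied.\<close>
  define c where "c = min (b N) (b (Suc N))"
  obtain y W where *: "W \<subseteq> {1..N}" "\<And>j. j \<in> {1..<N} \<Longrightarrow> j \<in> W \<or> Suc j \<in> W" "y 0 = 0" "y N = 0"
    "\<And>j. j \<in> {1..N} \<Longrightarrow> y (j - 1) + y j \<le> (b(N := b N - c)) j"
    "(\<Sum>j=1..<N. y j) = (\<Sum>j\<in>W. (b(N := b N - c)) j)"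
    using step.IH[of "b(N := b N - c)"] by blast
  have fin: "finite W" using *(1) finite_subset by blast
  have Suc_notin: "Suc N \<notin> W" using *(1) by auto
  have c: "c \<le> b N" "c \<le> b (Suc N)" by (auto simp: c_def)
  define z where "z = y(N := c, Suc N := 0)"
  have "(\<Sum>j=1..<N. z j) = (\<Sum>j=1..<N. y j)" by (rule sum.cong) (auto simp: z_def)
  then have sum_z: "(\<Sum>j=1..<Suc N. z j) = (\<Sum>j\<in>W. (b(N := b N - c)) j) + c"
    using step.hyps *(6) by (simp add: z_def)
  have z: "z 0 = 0" "z (Suc N) = 0" "\<forall>j\<in>{1..Suc N}. z (j - 1) + z j \<le> b j"
  proof -
    show "z 0 = 0" "z (Suc N) = 0" using step.hyps * by (auto simp: z_def)
    show "\<forall>j\<in>{1..Suc N}. z (j - 1) + z j \<le> b j"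
    proof
      fix j assume j: "j \<in> {1..Suc N}"
      consider "j = Suc N" | "j = N" | "j \<in> {1..<N}" using j by force
      then show "z (j - 1) + z j \<le> b j"
      proof cases
        case 1
        then show ?thesis using c by (simp add: z_def)
      next
        case 2
        then show ?thesis using c *(5)[of N] *(4) step.hyps by (auto simp: z_def)
      next
        case 3
        then show ?thesis using *(5)[of j] by (auto simp: z_def)
      qed
    qed
  qed
  have "\<exists>U. U \<subseteq> {1..Suc N} \<and> (\<forall>j\<in>{1..<Suc N}. j \<in> U \<or> Suc j \<in> U) \<and>
    (\<Sum>j\<in>W. (b(N := b N - c)) j) + c = (\<Sum>j\<in>U. b j)"
  proof (cases "N \<in> W")
    case True
    have "(\<Sum>j\<in>W. (b(N := b N - c)) j) + c = (\<Sum>j\<in>W. b j)"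
      using c(1) by (simp add: sum.remove[OF fin True])
    moreover have "\<forall>j\<in>{1..<Suc N}. j \<in> W \<or> Suc j \<in> W"
      using *(2) True by (metis atLeastLessThan_iff less_SucE)
    ultimately show ?thesis using *(1) by (intro exI[of _ W]) auto
  next
    case False
    have eq: "(\<Sum>j\<in>W. (b(N := b N - c)) j) = (\<Sum>j\<in>W. b j)"
      by (rule sum.cong) (use False in auto)
    \<comment> \<open>The last edge is not yet covered. By the choice of \<open>c\<close> one of its
      ends has capacity exactly \<open>c\<close>, so adding that end raises the cover weight by the
      multiplicity of the new edge.\<close>
    define i where "i = (if c = b N then N else Suc N)"
    have "b i = c" "i \<notin> W" "i \<in> {N, Suc N}" using False Suc_notin by (auto simp: i_def c_def)
    then show ?thesis
    proof (intro exI[of _ "insert i W"] conjI ballI)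
      fix j assume j: "j \<in> {1..<Suc N}"
      show "j \<in> insert i W \<or> Suc j \<in> insert i W"
      proof (cases "j = N")
        case True
        then show ?thesis using \<open>i \<in> {N, Suc N}\<close> by auto
      next
        case False
        then show ?thesis using *(2)[of j] j by auto
      qed
    qed (use *(1) eq fin step.hyps in auto)
  qed
  then obtain U where "U \<subseteq> {1..Suc N}" "\<forall>j\<in>{1..<Suc N}. j \<in> U \<or> Suc j \<in> U"
    "(\<Sum>j\<in>W. (b(N := b N - c)) j) + c = (\<Sum>j\<in>U. b j)" by blast
  then show ?case
    using z sum_z by (intro exI[of _ z] exI[of _ U]) simp
qed

section \<open>Covers and edge multiplicities of a cycle\<close>

definition cycle_cover :: "nat \<Rightarrow> nat set \<Rightarrow> bool"
  where "cycle_cover N W \<longleftrightarrow>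
    W \<subseteq> {1..N} \<and> (\<forall>j\<in>{1..<N}. j \<in> W \<or> Suc j \<in> W) \<and> (N \<in> W \<or> 1 \<in> W)"

text \<open>If two covers of the path have complements that are not disjoint, they can be swapped
  at a common missing vertex. This turns a cover avoiding both end points and a cover containing both
  into two covers of the cycle.\<close>

lemma path_covers_exchange:
  fixes a :: "nat \<Rightarrow> nat"
  assumes N: "N \<ge> 2"
    and W: "W \<subseteq> {1..N}" "\<forall>j\<in>{1..<N}. j \<in> W \<or> Suc j \<in> W" "1 \<notin> W" "N \<notin> W"
    and U: "U \<subseteq> {1..N}" "\<forall>j\<in>{1..<N}. j \<in> U \<or> Suc j \<in> U" "1 \<in> U" "N \<in> U"
    and cover: "\<And>C. cycle_cover N C \<Longrightarrow> r \<le> (\<Sum>j\<in>C. a j)"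
    and total: "2 * r \<le> (\<Sum>j=1..N. a j)"
  shows "2 * r \<le> (\<Sum>j\<in>W. a j) + (\<Sum>j\<in>U. a j)"
proof -
  have fin: "finite W" "finite U" using W(1) U(1) finite_subset by blast+
  show ?thesis
  proof (cases "W \<union> U = {1..N}")
    case True
    have "(\<Sum>j\<in>W. a j) + (\<Sum>j\<in>U. a j) \<ge> (\<Sum>j\<in>W \<union> U. a j)"
      using sum.union_inter[OF fin, of a] by linarith
    then show ?thesis using total True by simp
  next
    case False
    then obtain k where k: "k \<in> {1..N}" "k \<notin> W" "k \<notin> U" using W(1) U(1) by blast
    then have k1: "1 < k" "k < N" using U(3,4) by (auto simp: order.order_iff_strict)
    \<comment> \<open>Both covers miss \<open>k\<close>, so both contain its neighbours and can be
      cut and reglued there. The closing edge is covered through \<open>N\<close> in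
      \<open>C\<close> and through 1 in \<open>D\<close>, both inherited from \<open>U\<close>; the
      total weight is unchanged.\<close>
    define C where "C = (W \<inter> {..k}) \<union> (U \<inter> {k<..})"
    define D where "D = (U \<inter> {..k}) \<union> (W \<inter> {k<..})"
    have "(j \<in> C \<or> Suc j \<in> C) \<and> (j \<in> D \<or> Suc j \<in> D)" if j: "j \<in> {1..<N}" for j
    proof (cases "j = k")
      case True
      then show ?thesis using W(2) U(2) j k by (auto simp: C_def D_def)
    next
      case False
      then have "Suc j \<le> k \<or> k < j" by auto
      then show ?thesis using W(2) U(2) j by (auto simp: C_def D_def)
    qed
    moreover have "C \<subseteq> {1..N}" "D \<subseteq> {1..N}" "N \<in> C" "1 \<in> D"
      using W(1) U k1 by (auto simp: C_def D_def)
    ultimately have "cycle_cover N C" "cycle_cover N D"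
      unfolding cycle_cover_def by blast+
    then have "2 * r \<le> (\<Sum>j\<in>C. a j) + (\<Sum>j\<in>D. a j)"
      using cover[of C] cover[of D] by linarith
    also have "(\<Sum>j\<in>C. a j) = (\<Sum>j\<in>W \<inter> {..k}. a j) + (\<Sum>j\<in>U \<inter> {k<..}. a j)"
      unfolding C_def using fin by (intro sum.union_disjoint) auto
    also have "(\<Sum>j\<in>D. a j) = (\<Sum>j\<in>U \<inter> {..k}. a j) + (\<Sum>j\<in>W \<inter> {k<..}. a j)"
      unfolding D_def using fin by (intro sum.union_disjoint) auto
    also have "(\<Sum>j\<in>W \<inter> {..k}. a j) + (\<Sum>j\<in>U \<inter> {k<..}. a j) +
        ((\<Sum>j\<in>U \<inter> {..k}. a j) + (\<Sum>j\<in>W \<inter> {k<..}. a j)) =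
      ((\<Sum>j\<in>W \<inter> {..k}. a j) + (\<Sum>j\<in>W \<inter> {k<..}. a j)) +
      ((\<Sum>j\<in>U \<inter> {..k}. a j) + (\<Sum>j\<in>U \<inter> {k<..}. a j))" by simp
    also have "(\<Sum>j\<in>W \<inter> {..k}. a j) + (\<Sum>j\<in>W \<inter> {k<..}. a j) = (\<Sum>j\<in>W. a j)"
      using fin by (subst sum.union_disjoint[symmetric]) (auto intro!: sum.cong)
    also have "(\<Sum>j\<in>U \<inter> {..k}. a j) + (\<Sum>j\<in>U \<inter> {k<..}. a j) = (\<Sum>j\<in>U. a j)"
      using fin by (subst sum.union_disjoint[symmetric]) (auto intro!: sum.cong)
    finally show ?thesis .
  qed
qed

text \<open>The closing edge is taken \<open>s\<close> times, which lowers the capacities of 1 and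
  \<open>N\<close> by \<open>s\<close>; \<open>path_koenig\<close> handles the rest. The hypothesis
  \<open>cover\<close> says that the lowered weight of every path cover, plus \<open>s\<close>, is
  at least \<open>r\<close>. In the conclusion \<open>y j\<close> belongs to the edge from
  \<open>j\<close> to its cyclic successor, so \<open>y N\<close> is the closing edge.\<close>

lemma cycle_matching_of_multiplicity:
  fixes a :: "nat \<Rightarrow> nat"
  assumes N: "N \<ge> 2" and s: "s \<le> a 1" "s \<le> a N"
    and cover: "\<And>W. W \<subseteq> {1..N} \<Longrightarrow> \<forall>j\<in>{1..<N}. j \<in> W \<or> Suc j \<in> W \<Longrightarrow>
      r + (if 1 \<in> W then s else 0) + (if N \<in> W then s else 0) \<le> (\<Sum>j\<in>W. a j) + s"
  shows "\<exists>y. (\<forall>j\<in>{1..N}. y (if j = 1 then N else j - 1) + y j \<le> a j) \<and> (\<Sum>j=1..N. y j) \<ge> r"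
proof -
  define b where "b = a(1 := a 1 - s, N := a N - s)"
  obtain y W where *: "W \<subseteq> {1..N}" "\<forall>j\<in>{1..<N}. j \<in> W \<or> Suc j \<in> W" "y 0 = 0" "y N = 0"
    "\<forall>j\<in>{1..N}. y (j - 1) + y j \<le> b j" "(\<Sum>j=1..<N. y j) = (\<Sum>j\<in>W. b j)"
    using path_koenig[of N b] N by auto
  have fin: "finite W" using *(1) finite_subset by blast
  have "(\<Sum>j\<in>W. a j) = (\<Sum>j\<in>W. b j + (if j = 1 then s else 0) + (if j = N then s else 0))"
    by (rule sum.cong) (use N s in \<open>auto simp: b_def\<close>)
  also have "\<dots> = (\<Sum>j\<in>W. b j) + (if 1 \<in> W then s else 0) + (if N \<in> W then s else 0)"
    using fin by (simp add: sum.distrib)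
  finally have "r \<le> (\<Sum>j\<in>W. b j) + s"
    using cover[OF *(1,2)] by linarith
  define z where "z = y(N := s)"
  have "(\<Sum>j=1..N. z j) = (\<Sum>j=1..<N. z j) + s"
    using N by (cases N) (auto simp: z_def atLeastLessThanSuc_atLeastAtMost)
  also have "(\<Sum>j=1..<N. z j) = (\<Sum>j=1..<N. y j)" by (rule sum.cong) (auto simp: z_def)
  finally have "(\<Sum>j=1..N. z j) \<ge> r" using *(6) \<open>r \<le> (\<Sum>j\<in>W. b j) + s\<close> by simp
  moreover have "z (if j = 1 then N else j - 1) + z j \<le> a j" if j: "j \<in> {1..N}" for j
  proof -
    have "y (j - 1) + y j \<le> b j" using *(5) j by blast
    then show ?thesis using N s *(3,4) j by (auto simp: z_def b_def split: if_splits)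
  qed
  ultimately show ?thesis by blast
qed

text \<open>The multiplicity of the edge between \<open>N\<close> and \<open>1\<close> is the deficiency of the covers
  of the remaining path that avoid both of its end points.\<close>

lemma cycle_matching:
  fixes a :: "nat \<Rightarrow> nat"
  assumes N: "N \<ge> 2"
    and cover: "\<And>C. cycle_cover N C \<Longrightarrow> r \<le> (\<Sum>j\<in>C. a j)"
    and total: "2 * r \<le> (\<Sum>j=1..N. a j)"
  shows "\<exists>y. (\<forall>j\<in>{1..N}. y (if j = 1 then N else j - 1) + y j \<le> a j) \<and> (\<Sum>j=1..N. y j) \<ge> r"
proof -
  define F where "F = {W. W \<subseteq> {1..N} \<and> (\<forall>j\<in>{1..<N}. j \<in> W \<or> Suc j \<in> W) \<and> 1 \<notin> W \<and> N \<notin> W}"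
  have finW: "finite W" if "W \<subseteq> {1..N}" for W using that finite_subset by blast
  have F_fin: "finite F" unfolding F_def by (rule finite_subset[of _ "Pow {1..N}"]) auto
  \<comment> \<open>Natural subtraction truncates negative deficiencies to 0, and the inserted 0
    covers the case that \<open>F\<close> is empty.\<close>
  define s where "s = Max (insert 0 ((\<lambda>W. r - (\<Sum>j\<in>W. a j)) ` F))"
  have s_ge: "r \<le> (\<Sum>j\<in>W. a j) + s" if "W \<in> F" for W
  proof -
    have "r - (\<Sum>j\<in>W. a j) \<le> s" unfolding s_def using that F_fin by (intro Max_ge) auto
    then show ?thesis by linarith
  qed
  have "s \<in> insert 0 ((\<lambda>W. r - (\<Sum>j\<in>W. a j)) ` F)"
    unfolding s_def using F_fin by (intro Max_in) auto
  then consider "s = 0" | W0 where "W0 \<in> F" "s = r - (\<Sum>j\<in>W0. a j)" "s > 0" by blast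
  then show ?thesis
  proof cases
    case 1
    show ?thesis
    proof (rule cycle_matching_of_multiplicity[OF N])
      fix W assume W: "W \<subseteq> {1..N}" "\<forall>j\<in>{1..<N}. j \<in> W \<or> Suc j \<in> W"
      show "r + (if 1 \<in> W then s else 0) + (if N \<in> W then s else 0) \<le> (\<Sum>j\<in>W. a j) + s"
        using W cover[of W] s_ge[of W] 1 by (auto simp: F_def cycle_cover_def)
    qed (use 1 in auto)
  next
    case 2
    have W0: "W0 \<subseteq> {1..N}" "\<forall>j\<in>{1..<N}. j \<in> W0 \<or> Suc j \<in> W0" "1 \<notin> W0" "N \<notin> W0"
      using 2(1) by (auto simp: F_def)
    \<comment> \<open>Adding either end to \<open>W0\<close> gives a cover of the cycle, so each end
      must weigh at least the deficiency of \<open>W0\<close>.\<close>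
    have "cycle_cover N (insert 1 W0)" "cycle_cover N (insert N W0)"
      using W0 N by (auto simp: cycle_cover_def)
    then have s: "s \<le> a 1" "s \<le> a N"
      using cover[of "insert 1 W0"] cover[of "insert N W0"] W0 2 finW[of W0] by auto
    show ?thesis
    proof (rule cycle_matching_of_multiplicity[OF N s])
      fix W assume W: "W \<subseteq> {1..N}" "\<forall>j\<in>{1..<N}. j \<in> W \<or> Suc j \<in> W"
      consider "W \<in> F" | "1 \<in> W" "N \<in> W" | "(1 \<in> W) \<noteq> (N \<in> W)" using W by (auto simp: F_def)
      then show "r + (if 1 \<in> W then s else 0) + (if N \<in> W then s else 0) \<le> (\<Sum>j\<in>W. a j) + s"
      proof cases
        case 1
        then show ?thesis using s_ge[OF 1] by (simp add: F_def)
      next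
        case both: 2
        \<comment> \<open>Because \<open>s > 0\<close>, the weight of \<open>W0\<close> is exactly
          \<open>r - s\<close>. The exchange therefore forces weight at least \<open>r + s\<close>
          on \<open>W\<close>, which pays for both ends.\<close>
        have "2 * r \<le> (\<Sum>j\<in>W0. a j) + (\<Sum>j\<in>W. a j)"
          by (rule path_covers_exchange[OF N W0 W both cover total])
        then show ?thesis using 2 both by simp
      next
        case 3
        then have "cycle_cover N W" using W by (auto simp: cycle_cover_def)
        then show ?thesis using 3 cover[of W] by auto
      qed
    qed
  qed
qed

section \<open>Small covers of the odd cycle and averaging\<close>

lemma cycle_cover_card:
  assumes "cycle_cover (2 * n + 1) W"
  shows "n + 1 \<le> card W"
proof -
  let ?N = "2 * n + 1"
  let ?g = "\<lambda>j. if j = ?N then 1 else Suc j"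
  have fin: "finite W" and sub: "W \<subseteq> {1..?N}"
    using assms finite_subset by (auto simp: cycle_cover_def)
  have "card ({1..?N} - W) \<le> card W"
  \<comment> \<open>The cyclic successor of a vertex outside \<open>W\<close> lies in
    \<open>W\<close>.\<close>
  proof (rule card_inj_on_le[of ?g])
    show "inj_on ?g ({1..?N} - W)" by (auto simp: inj_on_def split: if_splits)
    show "?g ` ({1..?N} - W) \<subseteq> W" using assms
      by (auto simp: cycle_cover_def)
  qed (rule fin)
  moreover have "card ({1..?N} - W) = ?N - card W"
    using card_Diff_subset[OF fin sub] by simp
  ultimately show ?thesis by linarith
qed

text \<open>The cover consisting of every second vertex, except that \<open>c\<close> and its successor
  both belong to it.\<close>

definition alternating_cover :: "nat \<Rightarrow> nat \<Rightarrow> nat set"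
  where "alternating_cover N c = {i \<in> {1..N}. i \<le> c \<longleftrightarrow> even (c + i)}"

lemma cycle_cover_alternating:
  assumes "c \<in> {1..2 * n + 1}"
  shows "cycle_cover (2 * n + 1) (alternating_cover (2 * n + 1) c)"
  using assms unfolding cycle_cover_def alternating_cover_def by auto presburger+

text \<open>Counts the \<open>c\<close> up to \<open>k\<close> whose alternating cover contains
  \<open>i\<close>; general \<open>k\<close> permits induction. At k = 2n+1 the second branch gives
  n+1 for either parity of \<open>i\<close>, since 2n+2 and 2n+3 have the same integer half.\<close>

lemma sum_alternating:
  "(\<Sum>c=1..k. of_bool (i \<le> c \<longleftrightarrow> even (c + i))) =
    (if k < i then (k + of_bool (even i)) div 2 else (k + 1 + of_bool (even i)) div 2 :: nat)"
  if "i \<ge> 1"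
  using that by (induction k) (auto, presburger+)

text \<open>Double counting over the 2n+1 alternating covers: each weighs at least \<open>m\<close>,
  and each vertex lies in exactly n+1 of them.\<close>

lemma cycle_average:
  fixes a :: "nat \<Rightarrow> nat"
  assumes cover: "\<And>C. cycle_cover (2 * n + 1) C \<Longrightarrow> m \<le> (\<Sum>j\<in>C. a j)"
  shows "(2 * n + 1) * m \<le> (n + 1) * (\<Sum>j=1..2 * n + 1. a j)"
proof -
  let ?N = "2 * n + 1"
  have "?N * m = (\<Sum>c=1..?N. m)" by simp
  also have "\<dots> \<le> (\<Sum>c=1..?N. \<Sum>i\<in>alternating_cover ?N c. a i)"
    by (intro sum_mono cover cycle_cover_alternating)
  also have "\<dots> = (\<Sum>c=1..?N. \<Sum>i=1..?N. a i * of_bool (i \<le> c \<longleftrightarrow> even (c + i)))"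
    unfolding alternating_cover_def by (intro sum.cong sum.mono_neutral_cong_left) auto
  also have "\<dots> = (\<Sum>i=1..?N. a i * (\<Sum>c=1..?N. of_bool (i \<le> c \<longleftrightarrow> even (c + i))))"
    by (subst sum.swap) (simp only: sum_distrib_left)
  also have "\<dots> = (\<Sum>i=1..?N. a i * (n + 1))"
  proof (intro sum.cong refl arg_cong2[of _ _ _ _ "(*)"])
    fix i assume "i \<in> {1..?N}"
    then show "(\<Sum>c=1..?N. of_bool (i \<le> c \<longleftrightarrow> even (c + i))) = n + 1"
      using sum_alternating[of i ?N] by auto
  qed
  also have "\<dots> = (n + 1) * (\<Sum>i=1..?N. a i)"
    by (simp only: sum_distrib_right[symmetric] mult.commute)
  finally show ?thesis .
qed

section \<open>The resurgence of the odd cycle\<close>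

lemma cycle_edges_alt:
  assumes "N \<ge> 1"
  shows "cycle_edges N = (\<lambda>j. {if j = 1 then N else j - 1, j}) ` {1..N}"
proof (intro equalityI subsetI)
  fix e assume "e \<in> cycle_edges N"
  then consider j where "e = {j, Suc j}" "1 \<le> j" "j < N" | "e = {N, 1}"
    by (auto simp: cycle_edges_def)
  then show "e \<in> (\<lambda>j. {if j = 1 then N else j - 1, j}) ` {1..N}"
  proof cases
    case (1 j)
    then show ?thesis by (intro image_eqI[of _ _ "Suc j"]) auto
  next
    case 2
    then show ?thesis using assms by (intro image_eqI[of _ _ 1]) auto
  qed
next
  fix e assume "e \<in> (\<lambda>j. {if j = 1 then N else j - 1, j}) ` {1..N}"
  then obtain j where j: "j \<in> {1..N}" "e = {if j = 1 then N else j - 1, j}" by blast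
  show "e \<in> cycle_edges N"
  proof (cases "j = 1")
    case False
    then have "e = {j - 1, (j - 1) + 1}" "1 \<le> j - 1" "j - 1 < N" using j by auto
    then show ?thesis unfolding cycle_edges_def by blast
  qed (use j in \<open>simp add: cycle_edges_def\<close>)
qed

lemma finite_graph_cycle: "N \<ge> 2 \<Longrightarrow> finite_graph {1..N} (cycle_edges N)"
  by unfold_locales (auto simp: cycle_edges_alt split: if_splits)

lemma vertex_cover_cycle:
  "N \<ge> 1 \<Longrightarrow> vertex_cover {1..N} (cycle_edges N) W \<longleftrightarrow> cycle_cover N W"
  by (simp add: vertex_cover_def cycle_cover_def cycle_edges_def setcompr_eq_image ball_Un) auto

lemma weight_sum_singles:
  fixes a :: "'v \<Rightarrow> nat"
  assumes "finite V" "W \<subseteq> V"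
  shows "weight W (\<Sum>i\<in>V. Poly_Mapping.single i (a i)) = sum a W"
  unfolding weight_def using assms by (intro sum.cong) (auto simp: lookup_sum_singles)

lemma single_mem_edge_ideal_pow:
  fixes t :: "nat \<Rightarrow>\<^sub>0 nat"
  assumes N: "N \<ge> 2" and t: "Poly_Mapping.keys t \<subseteq> {1..N}"
    and cover: "\<And>C. cycle_cover N C \<Longrightarrow> r \<le> weight C t"
    and total: "2 * r \<le> weight {1..N} t"
  shows "Poly_Mapping.single t (1::'a::comm_ring_1) \<in>
    edge_ideal {1..N} (cycle_edges N) [^]\<^bsub>ideals_set (subring_on (mpolys {1..N}))\<^esub> r"
proof -
  interpret finite_graph "{1..N}" "cycle_edges N" using N by (rule finite_graph_cycle)
  let ?I = "edge_ideal {1..N} (cycle_edges N) :: ((nat \<Rightarrow>\<^sub>0 nat) \<Rightarrow>\<^sub>0 'a) set"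
  let ?p = "\<lambda>j. if j = 1 then N else j - 1"
  obtain y where y: "\<And>j. j \<in> {1..N} \<Longrightarrow> y (?p j) + y j \<le> Poly_Mapping.lookup t j"
    "(\<Sum>j=1..N. y j) \<ge> r"
    using cycle_matching[OF N, of r "Poly_Mapping.lookup t"] cover total unfolding weight_def by metis
  let ?s = "\<lambda>j. if j = N then 1 else Suc j"
  have edge: "mvar j * mvar (?s j) \<in> ?I" if "j \<in> {1..N}" for j
    using that by (intro edge_mem_edge_ideal) (auto simp: cycle_edges_def)
  have "(\<Prod>j=1..N. (mvar j * mvar (?s j)) ^ y j) \<in>
      ?I [^]\<^bsub>ideals_set (subring_on (mpolys {1..N}))\<^esub> (\<Sum>j=1..N. y j)"
    using edge by (intro prod_power_mem_ideal_pow cring_mpolys) auto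
  then have mem: "(\<Prod>j=1..N. (mvar j * mvar (?s j)) ^ y j) \<in>
      ?I [^]\<^bsub>ideals_set (subring_on (mpolys {1..N}))\<^esub> r"
    using ideal_pow_antimono[OF cring_mpolys ideal_edge_ideal y(2)] by blast
  define u where "u = (\<Sum>j=1..N. Poly_Mapping.single j (y j) + Poly_Mapping.single (?s j) (y j))"
  have u: "(\<Prod>j=1..N. (mvar j * mvar (?s j)) ^ y j) =
      (Poly_Mapping.single u 1 :: (nat \<Rightarrow>\<^sub>0 nat) \<Rightarrow>\<^sub>0 'a)"
    unfolding u_def by (simp add: prod_single[symmetric] power_mult_distrib mvar_power mult_single)
  \<comment> \<open>Successor and predecessor are inverse on the cycle. After reindexing, the
    exponent of \<open>j\<close> in \<open>u\<close> is \<open>y j\<close> plus the multiplicity of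
    the preceding edge, the quantity bounded by \<open>cycle_matching\<close>.\<close>
  have bij: "(\<Sum>j=1..N. Poly_Mapping.single (?s j) (y j)) = (\<Sum>j=1..N. Poly_Mapping.single j (y (?p j)))"
    using N by (intro sum.reindex_bij_witness[of _ ?p ?s]) (auto split: if_splits)
  have le: "Poly_Mapping.lookup u j \<le> Poly_Mapping.lookup t j" for j
    unfolding u_def sum.distrib bij lookup_add using y(1)[of j]
    by (simp add: lookup_sum_singles add.commute)
  show ?thesis
    using ring.ideal_pow_is_ideal[OF cring.axioms(1)[OF cring_mpolys] ideal_edge_ideal] mem[unfolded u] t le
    by (rule single_mem_ideal_mono)
qed

section \<open>Containment and non-containment\<close>

lemma symbolic_power_subset_edge_ideal_pow:
  assumes n: "n \<ge> 1" and N: "N = 2 * n + 1" and mr: "(2 * n + 2) * r \<le> N * m"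
  shows "symbolic_power (mpoly_ring {1..N}) (edge_ideal {1..N} (cycle_edges N)) m \<subseteq>
    (edge_ideal {1..N} (cycle_edges N) :: ((nat \<Rightarrow>\<^sub>0 nat) \<Rightarrow>\<^sub>0 'a::idom) set)
      [^]\<^bsub>ideals_set (mpoly_ring {1..N})\<^esub> r"
proof
  interpret finite_graph "{1..N}" "cycle_edges N" using n N by (intro finite_graph_cycle) simp
  fix f :: "(nat \<Rightarrow>\<^sub>0 nat) \<Rightarrow>\<^sub>0 'a"
  assume "f \<in> symbolic_power (mpoly_ring {1..N}) (edge_ideal {1..N} (cycle_edges N)) m"
  then have f: "f \<in> mpolys {1..N}" "\<And>W. cycle_cover N W \<Longrightarrow> f \<in> weight_ideal {1..N} W m"
    using vertex_cover_cycle[of N] N unfolding mem_symbolic_power_iff by simp_all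
  show "f \<in> edge_ideal {1..N} (cycle_edges N) [^]\<^bsub>ideals_set (mpoly_ring {1..N})\<^esub> r"
    unfolding mpoly_ring_eq_subring_on
  proof (rule mem_ideal_of_monomials[OF ring.ideal_pow_is_ideal[OF cring.axioms(1)[OF cring_mpolys] ideal_edge_ideal] f(1)])
    fix t assume t: "t \<in> Poly_Mapping.keys f"
    have cover: "m \<le> weight C t" if "cycle_cover N C" for C
      using f(2)[OF that] t by (auto simp: weight_ideal_def)
    have "N * m \<le> (n + 1) * weight {1..N} t"
      using cycle_average[of n m "Poly_Mapping.lookup t"] cover unfolding weight_def N by blast
    \<comment> \<open>Chaining \<open>mr\<close> with the average gives 2(n+1)r at most n+1 times
      the degree of \<open>t\<close>; the contradiction serves to cancel n+1.\<close>
    have total: "2 * r \<le> weight {1..N} t"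
    proof (rule ccontr)
      assume "\<not> ?thesis"
      then have "weight {1..N} t + 1 \<le> 2 * r" by simp
      then have "(n + 1) * (weight {1..N} t + 1) \<le> (n + 1) * (2 * r)" by (rule mult_le_mono2)
      with \<open>N * m \<le> (n + 1) * weight {1..N} t\<close> mr N show False
        by (simp add: algebra_simps)
    qed
    show "Poly_Mapping.single t 1 \<in>
      edge_ideal {1..N} (cycle_edges N) [^]\<^bsub>ideals_set (subring_on (mpolys {1..N}))\<^esub> r"
    proof (rule single_mem_edge_ideal_pow[OF _ _ _ total])
      show "N \<ge> 2" using n N by simp
      have "N * r \<le> (2 * n + 2) * r" by (rule mult_le_mono1) (simp add: N)
      with mr have "N * r \<le> N * m" by (rule order_trans[rotated])
      moreover have "0 < N" using N by simp
      ultimately have "r \<le> m" by simp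
      then show "r \<le> weight C t" if "cycle_cover N C" for C
        using cover[OF that] by simp
      show "Poly_Mapping.keys t \<subseteq> {1..N}" using f(1) t by (auto simp: mpolys_def)
    qed
  qed
qed

lemma symbolic_power_not_subset_edge_ideal_pow:
  fixes l n :: nat
  assumes n: "n \<ge> 1" and N: "N = 2 * n + 1"
  shows "\<not> symbolic_power (mpoly_ring {1..N})
      (edge_ideal {1..N} (cycle_edges N)) (2 * l * (n + 1)) \<subseteq>
    (edge_ideal {1..N} (cycle_edges N) :: ((nat \<Rightarrow>\<^sub>0 nat) \<Rightarrow>\<^sub>0 'a::idom) set)
      [^]\<^bsub>ideals_set (mpoly_ring {1..N})\<^esub> (l * N + 1)"
proof
  let ?I = "edge_ideal {1..N} (cycle_edges N) :: ((nat \<Rightarrow>\<^sub>0 nat) \<Rightarrow>\<^sub>0 'a) set"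
  assume sub: "symbolic_power (mpoly_ring {1..N}) ?I (2 * l * (n + 1)) \<subseteq>
    ?I [^]\<^bsub>ideals_set (mpoly_ring {1..N})\<^esub> (l * N + 1)"
  interpret finite_graph "{1..N}" "cycle_edges N" using n N by (intro finite_graph_cycle) simp
  define t where "t = (\<Sum>i=1..N. Poly_Mapping.single i (2 * l))"
  have weight_t: "weight W t = 2 * l * card W" if "W \<subseteq> {1..N}" for W
    unfolding t_def using that by (subst weight_sum_singles) auto
  define f where "f = (Poly_Mapping.single t 1 :: (nat \<Rightarrow>\<^sub>0 nat) \<Rightarrow>\<^sub>0 'a)"
  have "Poly_Mapping.keys t \<subseteq> {1..N}"
    by (auto simp: t_def in_keys_iff lookup_sum_singles split: if_splits)
  then have f: "f \<in> mpolys {1..N}" by (simp add: f_def single_mem_mpolys)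
  have "f \<in> weight_ideal {1..N} W (2 * l * (n + 1))" if W: "vertex_cover {1..N} (cycle_edges N) W" for W
  proof -
    have "cycle_cover N W" using W N vertex_cover_cycle[of N] by simp
    then have "n + 1 \<le> card W" unfolding N by (rule cycle_cover_card)
    then have "2 * l * (n + 1) \<le> weight W t"
      using weight_t W by (simp add: vertex_cover_def del: mult_Suc_right)
    then show ?thesis using f by (simp add: weight_ideal_def f_def)
  qed
  then have "f \<in> ?I [^]\<^bsub>ideals_set (subring_on (mpolys {1..N}))\<^esub> (l * N + 1)"
    using f sub unfolding mpoly_ring_eq_subring_on[symmetric] subset_iff mem_symbolic_power_iff by blast
  \<comment> \<open>On the full vertex set the weight is the degree. Elements of the power lN+1 have
    all terms of degree at least 2lN+2, whereas \<open>t\<close> has degree 2lN; the even exponent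
    makes this the first power excluded by degree.\<close>
  moreover have "2 \<le> card (e \<inter> {1..N})" if "e \<in> cycle_edges N" for e
    using edge_sub[OF that] edge_card[OF that] by (simp add: Int_absorb2)
  ultimately have "f \<in> weight_ideal {1..N} {1..N} ((l * N + 1) * 2)"
    using edge_ideal_pow_sub_weight_ideal[of "{1..N}" 2 "l * N + 1"] by blast
  then show False using weight_t[of "{1..N}"] by (simp add: weight_ideal_def f_def)
qed

theorem theorem5p11:
  fixes n :: nat
    and I :: "((nat \<Rightarrow>\<^sub>0 nat) \<Rightarrow>\<^sub>0 'k::alg_closed_field) set"
  assumes "n \<ge> 1"
    and "I = edge_ideal {1..2 * n + 1} (cycle_edges (2 * n + 1))"
  shows "resurgence (mpoly_ring {1..2 * n + 1}) I = ereal ((2 * real n + 2) / (2 * real n + 1))"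
proof (rule order_antisym)
  let ?R = "mpoly_ring {1..2 * n + 1} :: ((nat \<Rightarrow>\<^sub>0 nat) \<Rightarrow>\<^sub>0 'k) ring"
  let ?q = "(2 * real n + 2) / (2 * real n + 1)"
  show "resurgence ?R I \<le> ereal ?q"
    unfolding resurgence_def
  proof (rule Sup_least)
    fix x assume "x \<in> {ereal (real m / real r) |m r. m \<ge> 1 \<and> r \<ge> 1 \<and>
      \<not> symbolic_power ?R I m \<subseteq> I [^]\<^bsub>ideals_set ?R\<^esub> r}"
    then obtain m r where x: "x = ereal (real m / real r)" and mr: "r \<ge> 1"
      "\<not> symbolic_power ?R I m \<subseteq> I [^]\<^bsub>ideals_set ?R\<^esub> r" by blast
    have "\<not> (2 * n + 2) * r \<le> (2 * n + 1) * m"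
      using symbolic_power_subset_edge_ideal_pow[OF assms(1) refl, of r m] mr(2) assms(2) by blast
    then have "(2 * n + 1) * m \<le> (2 * n + 2) * r" by linarith
    then have "(2 * real n + 1) * real m \<le> (2 * real n + 2) * real r"
      using of_nat_le_iff[where 'a = real, of "(2 * n + 1) * m" "(2 * n + 2) * r"]
      by (simp add: algebra_simps)
    then show "x \<le> ereal ?q"
      unfolding x using mr by (simp add: divide_simps mult.commute)
  qed
  show "ereal ?q \<le> resurgence ?R I"
  proof -
    \<comment> \<open>Using \<open>Suc l\<close> keeps the symbolic exponent positive. Dividing
      numerator and denominator by \<open>Suc l\<close> leaves the target quotient up to a vanishing
      term in the denominator.\<close>
    let ?x = "\<lambda>l. real (2 * Suc l * (n + 1)) / real (Suc l * (2 * n + 1) + 1)"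
    have "(\<lambda>l. (2 * real n + 2) / (2 * real n + 1 + inverse (real (Suc l)))) \<longlonglongrightarrow>
        (2 * real n + 2) / (2 * real n + 1 + 0)"
      by (intro tendsto_intros LIMSEQ_inverse_real_of_nat) linarith
    moreover have "(2 * real n + 2) / (2 * real n + 1 + inverse (real (Suc l))) = ?x l" for l
    proof -
      have denom: "2 * real n + 1 + inverse (real (Suc l)) = real (Suc l * (2 * n + 1) + 1) / real (Suc l)"
        by (simp add: field_simps)
      have num: "2 * real n + 2 = real (2 * Suc l * (n + 1)) / real (Suc l)"
        by (simp add: field_simps)
      show ?thesis unfolding denom num by simp
    qed
    ultimately have lim: "(\<lambda>l. ereal (?x l)) \<longlonglongrightarrow> ereal ?q"
      by (simp only: add_0_right lim_ereal)
    have "ereal (?x l) \<le> resurgence ?R I" for l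
      unfolding resurgence_def
    proof (rule Sup_upper, rule CollectI, intro exI conjI)
      show "\<not> symbolic_power ?R I (2 * Suc l * (n + 1)) \<subseteq>
          I [^]\<^bsub>ideals_set ?R\<^esub> (Suc l * (2 * n + 1) + 1)"
        unfolding assms(2) by (rule symbolic_power_not_subset_edge_ideal_pow[OF assms(1) refl])
    qed simp_all
    then show ?thesis using LIMSEQ_le_const2[OF lim] by blast
  qed
qed

end
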